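(* Let $\mathbf{H}=(H,m,e,\delta,\varepsilon,\lambda)$ be a bimonad on a Cauchy complete category $\mathbb{A}$. Let $\underline{H}=(H,m,e)$ be its monad part and $\overline{H}=(H,\delta,\varepsilon)$ its comonad part. The following are equivalent: (a) $(\phi_{\underline{H}},\alpha_{K_{\underline{H}}})$ is $\widehat{\overline{H}}$-Galois, i.e. the composite $\phi_{\underline{H}}U_{\underline{H}}\xrightarrow{\alpha_{K_{\underline{H}}}U_{\underline{H}}}\widehat{\overline{H}}\phi_{\underline{H}}U_{\underline{H}}\xrightarrow{\widehat{\overline{H}}\varepsilon_{\underline{H}}}\widehat{\overline{H}}$ is an isomorphism; (b) $(\phi^{\overline{H}},\alpha_{K_{\overline{H}}})$ is $\widehat{\underline{H}}$-Galois, i.e. the composite $\widehat{\underline{H}}\xrightarrow{\widehat{\underline{H}}\eta^{\overline{H}}}\widehat{\underline{H}}\phi^{\overline{H}}U^{\overline{H}}\xrightarrow{\alpha_{K_{\overline{H}}}U^{\overline{H}}}\phi^{\overline{H}}U^{\overline{H}}$ is an isomorphism; (c) the unit $e:1\to H$ is a Galois grouplike morphism; (d) the functor $K_H:\mathbb{A}\to\mathbb{A}^H_H$, $a\mapsto(H(a),m_a,\delta_a)$ (hence also $K_{\underline{H}}:\mathbb{A}\to(\mathbb{A}_{\underline{H}})^{\widehat{\overline{H}}}$ and $K_{\overline{H}}:\mathbb{A}\to(\mathbb{A}^{\overline{H}})_{\widehat{\underline{H}}}$) is an equivalence of categories; (e) $(H,m)$ is $\overline{H}$-Galois, i.e. $HH\xrightarrow{\delta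 H}HHH\xrightarrow{Hm}HH$ is an isomorphism; (f) $(H,\delta)$ is $\underline{H}$-Galois, i.e. $HH\xrightarrow{H\delta}HHH\xrightarrow{mH}HH$ is an isomorphism; (g) $\mathbf{H}$ has an antipode, i.e. there exists a natural transformation $S:H\to H$ with $m\cdot HS\cdot\delta=e\cdot\varepsilon=m\cdot SH\cdot\delta$.
   Context: Cauchy complete means that all idempotents split. For a monad $\mathbf{T}$ on $\mathbb{A}$, $\phi_T\dashv U_T:\mathbb{A}_T\to\mathbb{A}$ is the free-forgetful adjunction of its Eilenberg–Moore category, with counit $\varepsilon_T$; for a comonad $\mathbf{G}$, $U^G\dashv\phi^G:\mathbb{A}\to\mathbb{A}^G$ is the forgetful-cofree adjunction, with unit $\eta^G$. An entwining from a monad $\mathbf{T}=(T,m,e)$ to a comonad $\mathbf{G}=(G,\delta,\varepsilon)$ is a natural transformation $\lambda:TG\to GT$ with $\lambda\cdot eG=Ge$, $\varepsilon T\cdot\lambda=T\varepsilon$, $\delta T\cdot\lambda=G\lambda\cdot\lambda G\cdot T\delta$, $\lambda\cdot mG=Gm\cdot\lambda T\cdot T\lambda$. It induces the comonad $\widehat{\mathbf{G}}$ on $\mathbb{A}_T$, $\widehat{G}(a,h)=(G(a),G(h)\cdot\lambda_a)$ (comultiplication $\delta_a$, counit $\varepsilon_a$), and the monad $\widehat{\mathbf{T}}$ on $\mathbb{A}^G$, $\widehat{T}(a,\theta)=(T(a),\lambda_a\cdot T(\theta))$ (multiplication $m_a$, unit $e_a$). $\mathbb{A}^G_T(\lambda)$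 is the category of triples $(a,h,\theta)$ with $(a,h)\in\mathbb{A}_T$, $(a,\theta)\in\mathbb{A}^G$ and $\theta\cdot h=G(h)\cdot\lambda_a\cdot T(\theta)$; there are canonical isomorphisms $\mathbb{A}^G_T(\lambda)\simeq(\mathbb{A}_T)^{\widehat{G}}\simeq(\mathbb{A}^G)_{\widehat{T}}$. A bimonad $\mathbf{H}$ on $\mathbb{A}$ is an endofunctor $H$ with a monad structure $\underline{H}=(H,m,e)$, a comonad structure $\overline{H}=(H,\delta,\varepsilon)$ and an entwining $\lambda:HH\to HH$ from $\underline{H}$ to $\overline{H}$ such that $\varepsilon\cdot m=\varepsilon\cdot\varepsilon H=\varepsilon\cdot H\varepsilon$, $\delta\cdot e=eH\cdot e=He\cdot e$, $\varepsilon\cdot e=1$, and $\delta\cdot m=Hm\cdot\lambda H\cdot H\delta$. Write $\mathbb{A}^H_H=\mathbb{A}^{\overline{H}}_{\underline{H}}(\lambda)$. $K_{\underline{H}}$ and $K_{\overline{H}}$ are the composites of $K_H$ with the isomorphisms $\mathbb{A}^H_H\simeq(\mathbb{A}_{\underline{H}})^{\widehat{\overline{H}}}$ and $\mathbb{A}^H_H\simeq(\mathbb{A}^{\overline{H}})_{\widehat{\underline{H}}}$. The transformation $\alpha_{K_{\underline{H}}}:\phi_{\underline{H}}\to\widehat{\overline{H}}\phi_{\underline{H}}$ is the $\widehat{\overline{H}}$-comodule structure with $a$-component $\delta_a:H(a)\to HH(a)$, and $\alpha_{K_{\overline{H}}}:\widehat{\underline{H}}\phi^{\overline{H}}\to\phi^{\overline{H}}$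 is the $\widehat{\underline{H}}$-module structure with $a$-component $m_a:HH(a)\to H(a)$. Galois grouplike morphisms. Let $\lambda:TG\to GT$ be an entwining from $\mathbf{T}$ to $\mathbf{G}$. A grouplike morphism is a natural transformation $g:1\to G$ with $\varepsilon\cdot g=1$ and $\delta\cdot g=Gg\cdot g$ (a comonad morphism from the identity comonad); for a bimonad, $e:1\to H$ is one. Put $\tilde g=\lambda\cdot Tg:T\to GT$, and let $i:T^g\to T$ be the (objectwise) equaliser of $gT,\tilde g:T\to GT$; $T^g$ carries a unique monad structure making $i$ a monad morphism. Let $i^*:\mathbb{A}_T\to\mathbb{A}_{T^g}$, $(a,h)\mapsto(a,h\cdot i_a)$, and let $i_*$ be its left adjoint. For $(a,h)\in\mathbb{A}_{T^g}$ let $q:\phi_T(a)\to i_*(a,h)$ be the $\mathbf{T}$-module morphism corresponding to the unit $a\to U_Ti_*(a,h)$ of $i_*\dashv i^*$, and let $\alpha_{(a,h)}:i_*(a,h)\to\widehat{G}i_*(a,h)$ be the unique morphism with $\alpha_{(a,h)}\cdot q=\widehat{G}(q)\cdot\tilde g_a$; this makes $i_*$ a $\widehat{\mathbf{G}}$-comodule. Then $g$ is a Galois grouplike morphism if the comonad morphism $i_*i^*\xrightarrow{\alpha i^*}\widehat{G}i_*i^*\to\widehat{G}$ (the second arrow being $\widehat{G}$ applied to the counit of $i_*\dashv i^*$) is an isomorphism; existence of $T^g$ and of $i_*$ is understood to be part of this notion. In (c), $\mathbf{T}=\underline{H}$, $\mathbf{G}=\overline{H}$, $g=e$. *)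

theory Defs
  imports Main
begin

section \<open>Categories, functors and natural transformations\<close>

text \<open>
  Categories are two-sorted: a set of objects, a set of arrows, and total operations that matter
  only on these sets. \<open>g \<cdot>\<^bsub>C\<^esub> f\<close> is the composite ``\<open>f\<close>, then \<open>g\<close>''.
\<close>

record ('o, 'm) cat =
  Obj :: "'o set"
  Arr :: "'m set"
  Dom :: "'m \<Rightarrow> 'o"
  Cod :: "'m \<Rightarrow> 'o"
  Idn :: "'o \<Rightarrow> 'm"
  Comp :: "'m \<Rightarrow> 'm \<Rightarrow> 'm" (infixr "\<cdot>\<index>" 70)

definition hom :: "('o, 'm) cat \<Rightarrow> 'o \<Rightarrow> 'o \<Rightarrow> 'm set" where
  "hom C a b = {f \<in> Arr C. Dom C f = a \<and> Cod C f = b}"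

locale category =
  fixes C :: "('o, 'm) cat" (structure)
  assumes dom_obj: "f \<in> Arr C \<Longrightarrow> Dom C f \<in> Obj C"
    and cod_obj: "f \<in> Arr C \<Longrightarrow> Cod C f \<in> Obj C"
    and idn_hom: "a \<in> Obj C \<Longrightarrow> Idn C a \<in> hom C a a"
    and comp_hom: "\<lbrakk>f \<in> hom C a b; g \<in> hom C b c\<rbrakk> \<Longrightarrow> g \<cdot> f \<in> hom C a c"
    and comp_idn_right: "f \<in> hom C a b \<Longrightarrow> f \<cdot> Idn C a = f"
    and comp_idn_left: "f \<in> hom C a b \<Longrightarrow> Idn C b \<cdot> f = f"
    and comp_assoc:
      "\<lbrakk>f \<in> hom C a b; g \<in> hom C b c; h \<in> hom C c d\<rbrakk> \<Longrightarrow> (h \<cdot> g) \<cdot> f = h \<cdot> (g \<cdot> f)"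

definition is_iso :: "('o, 'm) cat \<Rightarrow> 'm \<Rightarrow> bool" where
  "is_iso C f \<longleftrightarrow> f \<in> Arr C \<and>
     (\<exists>g \<in> hom C (Cod C f) (Dom C f).
        g \<cdot>\<^bsub>C\<^esub> f = Idn C (Dom C f) \<and> f \<cdot>\<^bsub>C\<^esub> g = Idn C (Cod C f))"

definition cauchy_complete :: "('o, 'm) cat \<Rightarrow> bool" where
  "cauchy_complete C \<longleftrightarrow>
     (\<forall>a \<in> Obj C. \<forall>k \<in> hom C a a. k \<cdot>\<^bsub>C\<^esub> k = k \<longrightarrow>
        (\<exists>b \<in> Obj C. \<exists>r \<in> hom C a b. \<exists>s \<in> hom C b a.
           s \<cdot>\<^bsub>C\<^esub> r = k \<and> r \<cdot>\<^bsub>C\<^esub> s = Idn C b))"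

definition is_equaliser :: "('o, 'm) cat \<Rightarrow> 'm \<Rightarrow> 'm \<Rightarrow> 'm \<Rightarrow> bool" where
  "is_equaliser C i f g \<longleftrightarrow>
     i \<in> Arr C \<and> f \<in> hom C (Cod C i) (Cod C f) \<and> g \<in> hom C (Cod C i) (Cod C f) \<and>
     f \<cdot>\<^bsub>C\<^esub> i = g \<cdot>\<^bsub>C\<^esub> i \<and>
     (\<forall>k \<in> Arr C. Cod C k = Cod C i \<and> f \<cdot>\<^bsub>C\<^esub> k = g \<cdot>\<^bsub>C\<^esub> k \<longrightarrow>
        (\<exists>!u. u \<in> hom C (Dom C k) (Dom C i) \<and> i \<cdot>\<^bsub>C\<^esub> u = k))"

record ('o, 'm, 'p, 'n) func =
  ob :: "'o \<Rightarrow> 'p"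
  ar :: "'m \<Rightarrow> 'n"

locale is_functor = A: category A + B: category B
  for A :: "('o, 'm) cat" and B :: "('p, 'n) cat" +
  fixes F :: "('o, 'm, 'p, 'n) func"
  assumes ob_obj: "a \<in> Obj A \<Longrightarrow> ob F a \<in> Obj B"
    and ar_hom: "f \<in> hom A a b \<Longrightarrow> ar F f \<in> hom B (ob F a) (ob F b)"
    and ar_idn: "a \<in> Obj A \<Longrightarrow> ar F (Idn A a) = Idn B (ob F a)"
    and ar_comp: "\<lbrakk>f \<in> hom A a b; g \<in> hom A b c\<rbrakk> \<Longrightarrow> ar F (g \<cdot>\<^bsub>A\<^esub> f) = ar F g \<cdot>\<^bsub>B\<^esub> ar F f"

definition id_func :: "('o, 'm, 'o, 'm) func" where
  "id_func = \<lparr>ob = (\<lambda>a. a), ar = (\<lambda>f. f)\<rparr>"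

definition comp_func ::
  "('p, 'n, 'q, 'k) func \<Rightarrow> ('o, 'm, 'p, 'n) func \<Rightarrow> ('o, 'm, 'q, 'k) func"
  (infixr "\<circ>\<^sub>F" 75) where
  "G \<circ>\<^sub>F F = \<lparr>ob = (\<lambda>a. ob G (ob F a)), ar = (\<lambda>f. ar G (ar F f))\<rparr>"

text \<open>A natural transformation is given by its family of components.\<close>

locale natural_transformation = F: is_functor A B F + G: is_functor A B G
  for A :: "('o, 'm) cat" and B :: "('p, 'n) cat"
    and F :: "('o, 'm, 'p, 'n) func" and G :: "('o, 'm, 'p, 'n) func" +
  fixes t :: "'o \<Rightarrow> 'n"
  assumes component: "a \<in> Obj A \<Longrightarrow> t a \<in> hom B (ob F a) (ob G a)"
    and naturality: "f \<in> hom A a b \<Longrightarrow> t b \<cdot>\<^bsub>B\<^esub> ar F f = ar G f \<cdot>\<^bsub>B\<^esub> t a"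

definition natural_iso ::
  "('o, 'm) cat \<Rightarrow> ('p, 'n) cat \<Rightarrow> ('o, 'm, 'p, 'n) func \<Rightarrow> ('o, 'm, 'p, 'n) func \<Rightarrow>
   ('o \<Rightarrow> 'n) \<Rightarrow> bool" where
  "natural_iso A B F G t \<longleftrightarrow>
     natural_transformation A B F G t \<and> (\<forall>a \<in> Obj A. is_iso B (t a))"

definition is_equivalence ::
  "('o, 'm) cat \<Rightarrow> ('p, 'n) cat \<Rightarrow> ('o, 'm, 'p, 'n) func \<Rightarrow> bool" where
  "is_equivalence A B K \<longleftrightarrow> is_functor A B K \<and>
     (\<exists>L u v. is_functor B A L \<and>
        natural_iso A A id_func (L \<circ>\<^sub>F K) u \<and> natural_iso B B (K \<circ>\<^sub>F L) id_func v)"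

text \<open>\<open>L\<close> is left adjoint to \<open>R\<close>, with unit \<open>u\<close> and counit \<open>c\<close>.\<close>

definition is_adjunction ::
  "('o, 'm) cat \<Rightarrow> ('p, 'n) cat \<Rightarrow> ('o, 'm, 'p, 'n) func \<Rightarrow> ('p, 'n, 'o, 'm) func \<Rightarrow>
   ('o \<Rightarrow> 'm) \<Rightarrow> ('p \<Rightarrow> 'n) \<Rightarrow> bool" where
  "is_adjunction A B L R u c \<longleftrightarrow>
     is_functor A B L \<and> is_functor B A R \<and>
     natural_transformation A A id_func (R \<circ>\<^sub>F L) u \<and>
     natural_transformation B B (L \<circ>\<^sub>F R) id_func c \<and>
     (\<forall>a \<in> Obj A. c (ob L a) \<cdot>\<^bsub>B\<^esub> ar L (u a) = Idn B (ob L a)) \<and>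
     (\<forall>b \<in> Obj B. ar R (c b) \<cdot>\<^bsub>A\<^esub> u (ob R b) = Idn A (ob R b))"


section \<open>Monads, comonads and their Eilenberg--Moore categories\<close>

record ('o, 'm) monad_data =
  mfun :: "('o, 'm, 'o, 'm) func"
  mult :: "'o \<Rightarrow> 'm"
  unit :: "'o \<Rightarrow> 'm"

record ('o, 'm) comonad_data =
  cfun :: "('o, 'm, 'o, 'm) func"
  comult :: "'o \<Rightarrow> 'm"
  counit :: "'o \<Rightarrow> 'm"

locale monad = category A for A :: "('o, 'm) cat" (structure) +
  fixes T :: "('o, 'm) monad_data"
  assumes functor_T: "is_functor A A (mfun T)"
    and mult_nat: "natural_transformation A A (mfun T \<circ>\<^sub>F mfun T) (mfun T) (mult T)"
    and unit_nat: "natural_transformation A A id_func (mfun T) (unit T)"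
    and mult_assoc:
      "a \<in> Obj A \<Longrightarrow> mult T a \<cdot> ar (mfun T) (mult T a) = mult T a \<cdot> mult T (ob (mfun T) a)"
    and mult_unit_left: "a \<in> Obj A \<Longrightarrow> mult T a \<cdot> unit T (ob (mfun T) a) = Idn A (ob (mfun T) a)"
    and mult_unit_right: "a \<in> Obj A \<Longrightarrow> mult T a \<cdot> ar (mfun T) (unit T a) = Idn A (ob (mfun T) a)"

locale comonad = category A for A :: "('o, 'm) cat" (structure) +
  fixes G :: "('o, 'm) comonad_data"
  assumes functor_G: "is_functor A A (cfun G)"
    and comult_nat: "natural_transformation A A (cfun G) (cfun G \<circ>\<^sub>F cfun G) (comult G)"
    and counit_nat: "natural_transformation A A (cfun G) id_func (counit G)"
    and comult_coassoc:
      "a \<in> Obj A \<Longrightarrow> ar (cfun G) (comult G a) \<cdot> comult G a = comult G (ob (cfun G) a) \<cdot> comult G a"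
    and comult_counit_left:
      "a \<in> Obj A \<Longrightarrow> counit G (ob (cfun G) a) \<cdot> comult G a = Idn A (ob (cfun G) a)"
    and comult_counit_right:
      "a \<in> Obj A \<Longrightarrow> ar (cfun G) (counit G a) \<cdot> comult G a = Idn A (ob (cfun G) a)"

definition monad_morphism ::
  "('o, 'm) cat \<Rightarrow> ('o, 'm) monad_data \<Rightarrow> ('o, 'm) monad_data \<Rightarrow> ('o \<Rightarrow> 'm) \<Rightarrow> bool" where
  "monad_morphism A S T i \<longleftrightarrow>
     natural_transformation A A (mfun S) (mfun T) i \<and>
     (\<forall>a \<in> Obj A. i a \<cdot>\<^bsub>A\<^esub> unit S a = unit T a) \<and>
     (\<forall>a \<in> Obj A. i a \<cdot>\<^bsub>A\<^esub> mult S a =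
        mult T a \<cdot>\<^bsub>A\<^esub> ar (mfun T) (i a) \<cdot>\<^bsub>A\<^esub> i (ob (mfun S) a))"

text \<open>
  Objects with extra structure over \<open>A\<close>: \<open>X\<close> is the set of structured objects, \<open>U\<close> the underlying
  object, and \<open>P x f y\<close> says that \<open>f\<close> preserves the structures. An arrow is an arrow of \<open>A\<close>
  together with its structured domain and codomain, since one arrow of \<open>A\<close> may underlie several.
\<close>

definition structured_cat ::
  "('o, 'm) cat \<Rightarrow> 's set \<Rightarrow> ('s \<Rightarrow> 'o) \<Rightarrow> ('s \<Rightarrow> 'm \<Rightarrow> 's \<Rightarrow> bool) \<Rightarrow> ('s, 's \<times> 'm \<times> 's) cat" where
  "structured_cat A X U P =
     \<lparr>Obj = X,
      Arr = {(x, f, y). x \<in> X \<and> y \<in> X \<and> f \<in> hom A (U x) (U y) \<and> P x f y},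
      Dom = (\<lambda>(x, f, y). x),
      Cod = (\<lambda>(x, f, y). y),
      Idn = (\<lambda>x. (x, Idn A (U x), x)),
      Comp = (\<lambda>(y', g, z) (x, f, y). (x, g \<cdot>\<^bsub>A\<^esub> f, z))\<rparr>"

definition underlying_func :: "('s \<Rightarrow> 'o) \<Rightarrow> ('s, 's \<times> 'm \<times> 's, 'o, 'm) func" where
  "underlying_func U = \<lparr>ob = U, ar = (\<lambda>(x, f, y). f)\<rparr>"

text \<open>Functors between such categories, and from \<open>A\<close> to such a category, given by an object map
  \<open>p\<close> and an action \<open>t\<close> on the underlying arrows.\<close>

definition structured_func ::
  "('s \<Rightarrow> 'r) \<Rightarrow> ('m \<Rightarrow> 'n) \<Rightarrow> ('s, 's \<times> 'm \<times> 's, 'r, 'r \<times> 'n \<times> 'r) func" where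
  "structured_func p t = \<lparr>ob = p, ar = (\<lambda>(x, f, y). (p x, t f, p y))\<rparr>"

definition into_structured_func ::
  "('o, 'm) cat \<Rightarrow> ('o \<Rightarrow> 'r) \<Rightarrow> ('m \<Rightarrow> 'n) \<Rightarrow> ('o, 'm, 'r, 'r \<times> 'n \<times> 'r) func" where
  "into_structured_func A p t = \<lparr>ob = p, ar = (\<lambda>f. (p (Dom A f), t f, p (Cod A f)))\<rparr>"

type_synonym ('o, 'm) sobj = "'o \<times> 'm"
type_synonym ('o, 'm) sarr = "('o, 'm) sobj \<times> 'm \<times> ('o, 'm) sobj"

definition modules :: "('o, 'm) cat \<Rightarrow> ('o, 'm) monad_data \<Rightarrow> ('o, 'm) sobj set" where
  "modules A T = {(a, h). a \<in> Obj A \<and> h \<in> hom A (ob (mfun T) a) a \<and>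
     h \<cdot>\<^bsub>A\<^esub> mult T a = h \<cdot>\<^bsub>A\<^esub> ar (mfun T) h \<and> h \<cdot>\<^bsub>A\<^esub> unit T a = Idn A a}"

definition comodules :: "('o, 'm) cat \<Rightarrow> ('o, 'm) comonad_data \<Rightarrow> ('o, 'm) sobj set" where
  "comodules A G = {(a, th). a \<in> Obj A \<and> th \<in> hom A a (ob (cfun G) a) \<and>
     comult G a \<cdot>\<^bsub>A\<^esub> th = ar (cfun G) th \<cdot>\<^bsub>A\<^esub> th \<and> counit G a \<cdot>\<^bsub>A\<^esub> th = Idn A a}"

definition EM :: "('o, 'm) cat \<Rightarrow> ('o, 'm) monad_data \<Rightarrow> (('o, 'm) sobj, ('o, 'm) sarr) cat" where
  "EM A T = structured_cat A (modules A T) fst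
     (\<lambda>(a, h) f (b, k). f \<cdot>\<^bsub>A\<^esub> h = k \<cdot>\<^bsub>A\<^esub> ar (mfun T) f)"

definition coEM :: "('o, 'm) cat \<Rightarrow> ('o, 'm) comonad_data \<Rightarrow> (('o, 'm) sobj, ('o, 'm) sarr) cat" where
  "coEM A G = structured_cat A (comodules A G) fst
     (\<lambda>(a, th) f (b, ze). ze \<cdot>\<^bsub>A\<^esub> f = ar (cfun G) f \<cdot>\<^bsub>A\<^esub> th)"

definition forget :: "(('o, 'm) sobj, ('o, 'm) sarr, 'o, 'm) func" where
  "forget = underlying_func fst"

definition free :: "('o, 'm) cat \<Rightarrow> ('o, 'm) monad_data \<Rightarrow> ('o, 'm, ('o, 'm) sobj, ('o, 'm) sarr) func"
  where "free A T = into_structured_func A (\<lambda>a. (ob (mfun T) a, mult T a)) (ar (mfun T))"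

definition cofree ::
  "('o, 'm) cat \<Rightarrow> ('o, 'm) comonad_data \<Rightarrow> ('o, 'm, ('o, 'm) sobj, ('o, 'm) sarr) func"
  where "cofree A G = into_structured_func A (\<lambda>a. (ob (cfun G) a, comult G a)) (ar (cfun G))"

text \<open>The counit of the adjunction of \<open>free\<close> and \<open>forget\<close>, and the unit of the adjunction of
  \<open>forget\<close> and \<open>cofree\<close>; the underlying arrows are the structure maps.\<close>

definition EM_counit ::
  "('o, 'm) cat \<Rightarrow> ('o, 'm) monad_data \<Rightarrow> ('o, 'm) sobj \<Rightarrow> ('o, 'm) sarr" where
  "EM_counit A T x = (ob (free A T) (fst x), snd x, x)"

definition coEM_unit ::
  "('o, 'm) cat \<Rightarrow> ('o, 'm) comonad_data \<Rightarrow> ('o, 'm) sobj \<Rightarrow> ('o, 'm) sarr" where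
  "coEM_unit A G x = (x, snd x, ob (cofree A G) (fst x))"


section \<open>Entwinings\<close>

locale entwining = T: monad A T + G: comonad A G
  for A :: "('o, 'm) cat" (structure)
    and T :: "('o, 'm) monad_data" and G :: "('o, 'm) comonad_data" +
  fixes lam :: "'o \<Rightarrow> 'm"
  assumes lam_nat: "natural_transformation A A (mfun T \<circ>\<^sub>F cfun G) (cfun G \<circ>\<^sub>F mfun T) lam"
    and lam_unit: "a \<in> Obj A \<Longrightarrow> lam a \<cdot> unit T (ob (cfun G) a) = ar (cfun G) (unit T a)"
    and lam_counit: "a \<in> Obj A \<Longrightarrow> counit G (ob (mfun T) a) \<cdot> lam a = ar (mfun T) (counit G a)"
    and lam_comult: "a \<in> Obj A \<Longrightarrow> comult G (ob (mfun T) a) \<cdot> lam a =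
      ar (cfun G) (lam a) \<cdot> lam (ob (cfun G) a) \<cdot> ar (mfun T) (comult G a)"
    and lam_mult: "a \<in> Obj A \<Longrightarrow> lam a \<cdot> mult T (ob (cfun G) a) =
      ar (cfun G) (mult T a) \<cdot> lam (ob (mfun T) a) \<cdot> ar (mfun T) (lam a)"

text \<open>The lifted comonad on \<open>EM A T\<close> and the lifted monad on \<open>coEM A G\<close>.\<close>

definition hat_comonad ::
  "('o, 'm) cat \<Rightarrow> ('o, 'm) monad_data \<Rightarrow> ('o, 'm) comonad_data \<Rightarrow> ('o \<Rightarrow> 'm) \<Rightarrow>
   (('o, 'm) sobj, ('o, 'm) sarr) comonad_data" where
  "hat_comonad A T G lam =
     (let p = (\<lambda>(a, h). (ob (cfun G) a, ar (cfun G) h \<cdot>\<^bsub>A\<^esub> lam a)) in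
      \<lparr>cfun = structured_func p (ar (cfun G)),
       comult = (\<lambda>x. (p x, comult G (fst x), p (p x))),
       counit = (\<lambda>x. (p x, counit G (fst x), x))\<rparr>)"

definition hat_monad ::
  "('o, 'm) cat \<Rightarrow> ('o, 'm) monad_data \<Rightarrow> ('o, 'm) comonad_data \<Rightarrow> ('o \<Rightarrow> 'm) \<Rightarrow>
   (('o, 'm) sobj, ('o, 'm) sarr) monad_data" where
  "hat_monad A T G lam =
     (let p = (\<lambda>(a, th). (ob (mfun T) a, lam a \<cdot>\<^bsub>A\<^esub> ar (mfun T) th)) in
      \<lparr>mfun = structured_func p (ar (mfun T)),
       mult = (\<lambda>x. (p (p x), mult T (fst x), p x)),
       unit = (\<lambda>x. (x, unit T (fst x), p x))\<rparr>)"

text \<open>The category of mixed bimodules: triples of an object, a module structure and a comodule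
  structure, compatible via the entwining.\<close>

definition mixed_cat ::
  "('o, 'm) cat \<Rightarrow> ('o, 'm) monad_data \<Rightarrow> ('o, 'm) comonad_data \<Rightarrow> ('o \<Rightarrow> 'm) \<Rightarrow>
   ('o \<times> 'm \<times> 'm, ('o \<times> 'm \<times> 'm) \<times> 'm \<times> ('o \<times> 'm \<times> 'm)) cat" where
  "mixed_cat A T G lam = structured_cat A
     {(a, h, th). (a, h) \<in> modules A T \<and> (a, th) \<in> comodules A G \<and>
        th \<cdot>\<^bsub>A\<^esub> h = ar (cfun G) h \<cdot>\<^bsub>A\<^esub> lam a \<cdot>\<^bsub>A\<^esub> ar (mfun T) th}
     fst
     (\<lambda>(a, h, th) f (b, k, ze). f \<cdot>\<^bsub>A\<^esub> h = k \<cdot>\<^bsub>A\<^esub> ar (mfun T) f \<and>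
        ze \<cdot>\<^bsub>A\<^esub> f = ar (cfun G) f \<cdot>\<^bsub>A\<^esub> th)"

text \<open>The canonical isomorphisms from \<open>mixed_cat A T G lam\<close> to
  \<open>coEM (EM A T) (hat_comonad A T G lam)\<close> and to \<open>EM (coEM A G) (hat_monad A T G lam)\<close>.\<close>

definition mixed_to_comodules ::
  "('o, 'm) cat \<Rightarrow> ('o, 'm) monad_data \<Rightarrow> ('o, 'm) comonad_data \<Rightarrow> ('o \<Rightarrow> 'm) \<Rightarrow>
   ('o \<times> 'm \<times> 'm, ('o \<times> 'm \<times> 'm) \<times> 'm \<times> ('o \<times> 'm \<times> 'm),
    (('o, 'm) sobj, ('o, 'm) sarr) sobj, (('o, 'm) sobj, ('o, 'm) sarr) sarr) func" where
  "mixed_to_comodules A T G lam =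
     (let p = (\<lambda>(a, h, th). ((a, h), ((a, h), th, ob (cfun (hat_comonad A T G lam)) (a, h)))) in
      \<lparr>ob = p, ar = (\<lambda>(x, f, y). (p x, (fst (p x), f, fst (p y)), p y))\<rparr>)"

definition mixed_to_modules ::
  "('o, 'm) cat \<Rightarrow> ('o, 'm) monad_data \<Rightarrow> ('o, 'm) comonad_data \<Rightarrow> ('o \<Rightarrow> 'm) \<Rightarrow>
   ('o \<times> 'm \<times> 'm, ('o \<times> 'm \<times> 'm) \<times> 'm \<times> ('o \<times> 'm \<times> 'm),
    (('o, 'm) sobj, ('o, 'm) sarr) sobj, (('o, 'm) sobj, ('o, 'm) sarr) sarr) func" where
  "mixed_to_modules A T G lam =
     (let p = (\<lambda>(a, h, th). ((a, th), (ob (mfun (hat_monad A T G lam)) (a, th), h, (a, th)))) in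
      \<lparr>ob = p, ar = (\<lambda>(x, f, y). (p x, (fst (p x), f, fst (p y)), p y))\<rparr>)"


section \<open>Galois functors and Galois grouplike morphisms\<close>

text \<open>
  For \<open>L : A \<rightarrow> B\<close> left adjoint to \<open>R\<close> with counit \<open>c\<close>, a comonad \<open>G\<close> on \<open>B\<close> and a \<open>G\<close>-comodule
  structure \<open>al : L \<rightarrow> GL\<close>: the composite \<open>LR \<rightarrow> GLR \<rightarrow> G\<close> is an isomorphism.
\<close>

definition comodule_functor_galois ::
  "('p, 'n) cat \<Rightarrow> ('o, 'm, 'p, 'n) func \<Rightarrow> ('p, 'n, 'o, 'm) func \<Rightarrow> ('p \<Rightarrow> 'n) \<Rightarrow>
   ('p, 'n) comonad_data \<Rightarrow> ('o \<Rightarrow> 'n) \<Rightarrow> bool" where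
  "comodule_functor_galois B L R c G al \<longleftrightarrow>
     natural_iso B B (L \<circ>\<^sub>F R) (cfun G) (\<lambda>b. ar (cfun G) (c b) \<cdot>\<^bsub>B\<^esub> al (ob R b))"

text \<open>
  Dually, for \<open>R : A \<rightarrow> B\<close> right adjoint to \<open>L\<close> with unit \<open>u\<close>, a monad \<open>T\<close> on \<open>B\<close> and a
  \<open>T\<close>-module structure \<open>al : TR \<rightarrow> R\<close>: the composite \<open>T \<rightarrow> TRL \<rightarrow> RL\<close> is an isomorphism.
\<close>

definition module_functor_galois ::
  "('p, 'n) cat \<Rightarrow> ('o, 'm, 'p, 'n) func \<Rightarrow> ('p, 'n, 'o, 'm) func \<Rightarrow> ('p \<Rightarrow> 'n) \<Rightarrow>
   ('p, 'n) monad_data \<Rightarrow> ('o \<Rightarrow> 'n) \<Rightarrow> bool" where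
  "module_functor_galois B R L u T al \<longleftrightarrow>
     natural_iso B B (mfun T) (R \<circ>\<^sub>F L) (\<lambda>b. al (ob L b) \<cdot>\<^bsub>B\<^esub> ar (mfun T) (u b))"

definition grouplike :: "('o, 'm) cat \<Rightarrow> ('o, 'm) comonad_data \<Rightarrow> ('o \<Rightarrow> 'm) \<Rightarrow> bool" where
  "grouplike A G g \<longleftrightarrow>
     natural_transformation A A id_func (cfun G) g \<and>
     (\<forall>a \<in> Obj A. counit G a \<cdot>\<^bsub>A\<^esub> g a = Idn A a) \<and>
     (\<forall>a \<in> Obj A. comult G a \<cdot>\<^bsub>A\<^esub> g a = ar (cfun G) (g a) \<cdot>\<^bsub>A\<^esub> g a)"

definition grouplike_tilde ::
  "('o, 'm) cat \<Rightarrow> ('o, 'm) monad_data \<Rightarrow> ('o \<Rightarrow> 'm) \<Rightarrow> ('o \<Rightarrow> 'm) \<Rightarrow> 'o \<Rightarrow> 'm" where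
  "grouplike_tilde A T lam g a = lam a \<cdot>\<^bsub>A\<^esub> ar (mfun T) (g a)"

text \<open>Restriction along a monad morphism \<open>i\<close>.\<close>

definition restriction ::
  "('o, 'm) cat \<Rightarrow> ('o \<Rightarrow> 'm) \<Rightarrow> (('o, 'm) sobj, ('o, 'm) sarr, ('o, 'm) sobj, ('o, 'm) sarr) func"
  where "restriction A i = structured_func (\<lambda>(a, h). (a, h \<cdot>\<^bsub>A\<^esub> i a)) (\<lambda>f. f)"

text \<open>
  For a left adjoint \<open>L\<close> of a restriction functor into \<open>EM A T\<close>, with unit \<open>u\<close>: the \<open>T\<close>-module
  morphism from the free module on the underlying object of \<open>x\<close> to \<open>L x\<close> that is the transpose of
  the underlying arrow of \<open>u x\<close> under the free-forgetful adjunction of \<open>T\<close>.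
\<close>

definition induction_quotient ::
  "('o, 'm) cat \<Rightarrow> ('o, 'm) monad_data \<Rightarrow>
   (('o, 'm) sobj, ('o, 'm) sarr, ('o, 'm) sobj, ('o, 'm) sarr) func \<Rightarrow>
   (('o, 'm) sobj \<Rightarrow> ('o, 'm) sarr) \<Rightarrow> ('o, 'm) sobj \<Rightarrow> ('o, 'm) sarr" where
  "induction_quotient A T L u x =
     EM_counit A T (ob L x) \<cdot>\<^bsub>EM A T\<^esub> ar (free A T) (ar forget (u x))"

text \<open>
  The equaliser \<open>S\<close> with its monad structure, the left adjoint \<open>L\<close> and the coaction \<open>al\<close> are
  determined up to isomorphism by the conditions below, so that it does not matter which
  choices are made; their existence is part of the notion.
\<close>

definition galois_grouplike ::
  "('o, 'm) cat \<Rightarrow> ('o, 'm) monad_data \<Rightarrow> ('o, 'm) comonad_data \<Rightarrow> ('o \<Rightarrow> 'm) \<Rightarrow> ('o \<Rightarrow> 'm) \<Rightarrow> bool"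
  where
  "galois_grouplike A T G lam g \<longleftrightarrow>
     grouplike A G g \<and>
     (\<exists>S i L u c al.
        monad A S \<and> monad_morphism A S T i \<and>
        (\<forall>a \<in> Obj A. is_equaliser A (i a) (g (ob (mfun T) a)) (grouplike_tilde A T lam g a)) \<and>
        is_adjunction (EM A S) (EM A T) L (restriction A i) u c \<and>
        (\<forall>x \<in> Obj (EM A S).
           al x \<in> hom (EM A T) (ob L x) (ob (cfun (hat_comonad A T G lam)) (ob L x)) \<and>
           al x \<cdot>\<^bsub>EM A T\<^esub> induction_quotient A T L u x =
             ar (cfun (hat_comonad A T G lam)) (induction_quotient A T L u x) \<cdot>\<^bsub>EM A T\<^esub>
               (ob (free A T) (fst x),
                grouplike_tilde A T lam g (fst x),
                ob (cfun (hat_comonad A T G lam)) (ob (free A T) (fst x)))) \<and>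
        comodule_functor_galois (EM A T) L (restriction A i) c (hat_comonad A T G lam) al)"


section \<open>Bimonads\<close>

record ('o, 'm) bimonad_data =
  bfun :: "('o, 'm, 'o, 'm) func"
  bmult :: "'o \<Rightarrow> 'm"
  bunit :: "'o \<Rightarrow> 'm"
  bcomult :: "'o \<Rightarrow> 'm"
  bcounit :: "'o \<Rightarrow> 'm"
  bentw :: "'o \<Rightarrow> 'm"

definition monad_part :: "('o, 'm) bimonad_data \<Rightarrow> ('o, 'm) monad_data" where
  "monad_part H = \<lparr>mfun = bfun H, mult = bmult H, unit = bunit H\<rparr>"

definition comonad_part :: "('o, 'm) bimonad_data \<Rightarrow> ('o, 'm) comonad_data" where
  "comonad_part H = \<lparr>cfun = bfun H, comult = bcomult H, counit = bcounit H\<rparr>"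

locale bimonad = entwining A "monad_part H" "comonad_part H" "bentw H"
  for A :: "('o, 'm) cat" (structure) and H :: "('o, 'm) bimonad_data" +
  assumes counit_mult_1:
      "a \<in> Obj A \<Longrightarrow> bcounit H a \<cdot> bmult H a = bcounit H a \<cdot> bcounit H (ob (bfun H) a)"
    and counit_mult_2:
      "a \<in> Obj A \<Longrightarrow> bcounit H a \<cdot> bmult H a = bcounit H a \<cdot> ar (bfun H) (bcounit H a)"
    and comult_unit_1:
      "a \<in> Obj A \<Longrightarrow> bcomult H a \<cdot> bunit H a = bunit H (ob (bfun H) a) \<cdot> bunit H a"
    and comult_unit_2:
      "a \<in> Obj A \<Longrightarrow> bcomult H a \<cdot> bunit H a = ar (bfun H) (bunit H a) \<cdot> bunit H a"
    and counit_unit: "a \<in> Obj A \<Longrightarrow> bcounit H a \<cdot> bunit H a = Idn A a"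
    and comult_mult: "a \<in> Obj A \<Longrightarrow> bcomult H a \<cdot> bmult H a =
      ar (bfun H) (bmult H a) \<cdot> bentw H (ob (bfun H) a) \<cdot> ar (bfun H) (bcomult H a)"

definition bimonad_hat_comonad ::
  "('o, 'm) cat \<Rightarrow> ('o, 'm) bimonad_data \<Rightarrow> (('o, 'm) sobj, ('o, 'm) sarr) comonad_data" where
  "bimonad_hat_comonad A H = hat_comonad A (monad_part H) (comonad_part H) (bentw H)"

definition bimonad_hat_monad ::
  "('o, 'm) cat \<Rightarrow> ('o, 'm) bimonad_data \<Rightarrow> (('o, 'm) sobj, ('o, 'm) sarr) monad_data" where
  "bimonad_hat_monad A H = hat_monad A (monad_part H) (comonad_part H) (bentw H)"

definition bimodule_cat ::
  "('o, 'm) cat \<Rightarrow> ('o, 'm) bimonad_data \<Rightarrow>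
   ('o \<times> 'm \<times> 'm, ('o \<times> 'm \<times> 'm) \<times> 'm \<times> ('o \<times> 'm \<times> 'm)) cat" where
  "bimodule_cat A H = mixed_cat A (monad_part H) (comonad_part H) (bentw H)"

definition K_bimod ::
  "('o, 'm) cat \<Rightarrow> ('o, 'm) bimonad_data \<Rightarrow>
   ('o, 'm, 'o \<times> 'm \<times> 'm, ('o \<times> 'm \<times> 'm) \<times> 'm \<times> ('o \<times> 'm \<times> 'm)) func" where
  "K_bimod A H =
     into_structured_func A (\<lambda>a. (ob (bfun H) a, bmult H a, bcomult H a)) (ar (bfun H))"

definition K_monad ::
  "('o, 'm) cat \<Rightarrow> ('o, 'm) bimonad_data \<Rightarrow>
   ('o, 'm, (('o, 'm) sobj, ('o, 'm) sarr) sobj, (('o, 'm) sobj, ('o, 'm) sarr) sarr) func" where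
  "K_monad A H =
     mixed_to_comodules A (monad_part H) (comonad_part H) (bentw H) \<circ>\<^sub>F K_bimod A H"

definition K_comonad ::
  "('o, 'm) cat \<Rightarrow> ('o, 'm) bimonad_data \<Rightarrow>
   ('o, 'm, (('o, 'm) sobj, ('o, 'm) sarr) sobj, (('o, 'm) sobj, ('o, 'm) sarr) sarr) func" where
  "K_comonad A H =
     mixed_to_modules A (monad_part H) (comonad_part H) (bentw H) \<circ>\<^sub>F K_bimod A H"

text \<open>The comodule structure on the free functor and the module structure on the cofree functor
  that correspond to \<open>K_monad\<close> and \<open>K_comonad\<close>.\<close>

definition alpha_K_monad ::
  "('o, 'm) cat \<Rightarrow> ('o, 'm) bimonad_data \<Rightarrow> 'o \<Rightarrow> ('o, 'm) sarr" where
  "alpha_K_monad A H a =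
     (let x = ob (free A (monad_part H)) a in
      (x, bcomult H a, ob (cfun (bimonad_hat_comonad A H)) x))"

definition alpha_K_comonad ::
  "('o, 'm) cat \<Rightarrow> ('o, 'm) bimonad_data \<Rightarrow> 'o \<Rightarrow> ('o, 'm) sarr" where
  "alpha_K_comonad A H a =
     (let x = ob (cofree A (comonad_part H)) a in
      (ob (mfun (bimonad_hat_monad A H)) x, bmult H a, x))"

definition is_antipode :: "('o, 'm) cat \<Rightarrow> ('o, 'm) bimonad_data \<Rightarrow> ('o \<Rightarrow> 'm) \<Rightarrow> bool" where
  "is_antipode A H S \<longleftrightarrow>
     natural_transformation A A (bfun H) (bfun H) S \<and>
     (\<forall>a \<in> Obj A.
        bmult H a \<cdot>\<^bsub>A\<^esub> ar (bfun H) (S a) \<cdot>\<^bsub>A\<^esub> bcomult H a = bunit H a \<cdot>\<^bsub>A\<^esub> bcounit H a \<and>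
        bmult H a \<cdot>\<^bsub>A\<^esub> S (ob (bfun H) a) \<cdot>\<^bsub>A\<^esub> bcomult H a = bunit H a \<cdot>\<^bsub>A\<^esub> bcounit H a)"

definition all_equivalent :: "bool list \<Rightarrow> bool" where
  "all_equivalent ps \<longleftrightarrow> (\<forall>p \<in> set ps. \<forall>q \<in> set ps. p \<longleftrightarrow> q)"

end

theory Submission
  imports Defs
begin

text \<open>
  Write \<open>\<beta>\<^sub>h = H(h) \<cdot> \<delta>\<^sub>a : H(a) \<rightarrow> H(a)\<close> for an \<open>H\<close>-module \<open>(a, h)\<close>. All seven conditions amount to the
  invertibility of these maps, up to duality.

  Condition (a) says that every \<open>\<beta>\<^sub>h\<close> is invertible, and (e) says so for the free modules. If there is an
  antipode \<open>S\<close>, then \<open>H(h) \<cdot> H(S\<^sub>a) \<cdot> \<delta>\<^sub>a\<close> inverts \<open>\<beta>\<^sub>h\<close> (\<open>antipode_galois\<close>); conversely, from the inverse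
  \<open>I\<close> of \<open>Hm \<cdot> \<delta>H\<close> one gets the antipode \<open>\<epsilon>H \<cdot> I \<cdot> He\<close> (\<open>galois_antipode\<close>). The argument takes
  place with a monad and a comonad on one functor. Passing to the opposite category exchanges the two,
  leaves the notion of antipode as it is, and turns (a) and (e) into (b) and (f).

  The functor \<open>K\<^sub>H\<close> is fully faithful for any bimonad (\<open>K_full\<close>), so (d) is a matter of its essential
  image. Being a bimodule map from \<open>K\<^sub>H(a)\<close> to the cofree bimodule on \<open>(a, h)\<close>, \<open>\<beta>\<^sub>h\<close> is invertible as soon
  as this cofree bimodule is in the image (\<open>cofree_galois\<close>). Conversely, when the \<open>\<beta>\<^sub>h\<close> are invertible, a
  bimodule \<open>(a, h, \<theta>)\<close> is the free one on its coinvariants, which are split off by the idempotent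
  \<open>\<epsilon>\<^sub>a \<cdot> \<beta>\<^sub>h\<inverse> \<cdot> \<theta>\<close>; it is here that Cauchy completeness enters (\<open>galois_descent\<close>). As \<open>K_monad\<close> and
  \<open>K_comonad\<close> arise from \<open>K\<^sub>H\<close> by composition with isomorphisms of categories, they are equivalences
  along with it.

  For (c), \<open>\<lambda> \<cdot> He = \<delta>\<close> (\<open>l_F_e\<close>), and \<open>e\<close> itself is an equaliser of \<open>eH\<close> and \<open>\<delta>\<close>. The monad \<open>S\<close>
  carried by this equaliser is thus the identity up to isomorphism, the left adjoint of restriction
  along \<open>S \<rightarrow> H\<close> is the free module functor, and the Galois condition on the
  grouplike morphism \<open>e\<close> is (a) again (\<open>galois_grouplike_galois\<close>, \<open>free_galois_grouplike\<close>).
\<close>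

section \<open>Categories by domain and codomain equations\<close>

context category
begin

lemma homI: "\<lbrakk>f \<in> Arr C; Dom C f = a; Cod C f = b\<rbrakk> \<Longrightarrow> f \<in> hom C a b"
  by (simp add: hom_def)

lemma idn_arr [simp]:
  assumes "a \<in> Obj C"
  shows "Idn C a \<in> Arr C" "Dom C (Idn C a) = a" "Cod C (Idn C a) = a"
  using idn_hom[OF assms] by (simp_all add: hom_def)

lemma comp_arr [simp]:
  assumes "f \<in> Arr C" "g \<in> Arr C" "Dom C g = Cod C f"
  shows "g \<cdot> f \<in> Arr C" "Dom C (g \<cdot> f) = Dom C f" "Cod C (g \<cdot> f) = Cod C g"
  using comp_hom[of f "Dom C f" "Cod C f" g "Cod C g"] assms by (simp_all add: hom_def)

lemma comp_idn [simp]: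
  assumes "f \<in> Arr C"
  shows "Dom C f = a \<Longrightarrow> f \<cdot> Idn C a = f" "Cod C f = a \<Longrightarrow> Idn C a \<cdot> f = f"
  using comp_idn_right comp_idn_left assms by (auto simp: hom_def)

lemma assoc [simp]:
  assumes "f \<in> Arr C" "g \<in> Arr C" "h \<in> Arr C" "Dom C g = Cod C f" "Dom C h = Cod C g"
  shows "(h \<cdot> g) \<cdot> f = h \<cdot> g \<cdot> f"
  using comp_assoc[of f _ _ g _ h] assms by (simp add: hom_def)

declare dom_obj [simp] cod_obj [simp]

lemma paste:
  assumes "f \<cdot> g = p \<cdot> q" "f \<in> Arr C" "g \<in> Arr C" "p \<in> Arr C" "q \<in> Arr C" "k \<in> Arr C"
    "Dom C f = Cod C g" "Dom C g = Cod C k" "Dom C p = Cod C q" "Dom C q = Cod C k"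
  shows "f \<cdot> g \<cdot> k = p \<cdot> q \<cdot> k"
  using assms by (metis assoc)

definition inverse_arrows :: "'m \<Rightarrow> 'm \<Rightarrow> bool" where
  "inverse_arrows f g \<longleftrightarrow> f \<in> Arr C \<and> g \<in> Arr C \<and> Dom C g = Cod C f \<and> Cod C g = Dom C f \<and>
     g \<cdot> f = Idn C (Dom C f) \<and> f \<cdot> g = Idn C (Cod C f)"

lemma is_iso_iff: "is_iso C f \<longleftrightarrow> (\<exists>g. inverse_arrows f g)"
  by (auto simp: is_iso_def inverse_arrows_def hom_def)

lemma inverse_arrows_cancel [simp]:
  assumes "inverse_arrows f g" "k \<in> Arr C"
  shows "Cod C k = Dom C f \<Longrightarrow> g \<cdot> f \<cdot> k = k" "Cod C k = Cod C f \<Longrightarrow> f \<cdot> g \<cdot> k = k"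
  using assms by (simp_all add: inverse_arrows_def flip: assoc)

text \<open>
  A commuting square with two invertible parallel sides also commutes with these sides inverted:
  this is how inverses of Galois maps inherit naturality, linearity and colinearity.
\<close>

lemma inverse_arrows_swap:
  assumes i: "inverse_arrows f g" and i': "inverse_arrows f' g'"
    and x: "x \<in> Arr C" "Dom C x = Dom C f" "Cod C x = Dom C f'"
    and y: "y \<in> Arr C" "Dom C y = Cod C f" "Cod C y = Cod C f'"
    and c: "f' \<cdot> x = y \<cdot> f"
  shows "x \<cdot> g = g' \<cdot> y"
proof -
  note I = i[unfolded inverse_arrows_def] i'[unfolded inverse_arrows_def]
  have "x \<cdot> g = g' \<cdot> (f' \<cdot> x) \<cdot> g"
    using I x inverse_arrows_cancel(1)[OF i', of "x \<cdot> g"] by simp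
  also have "\<dots> = g' \<cdot> y"
    using I x y by (simp add: c)
  finally show ?thesis .
qed

lemma is_iso_cancel:
  assumes i: "is_iso C f" and x: "x \<in> Arr C" "y \<in> Arr C" "Cod C x = Dom C f" "Cod C y = Dom C f"
    and eq: "f \<cdot> x = f \<cdot> y"
  shows "x = y"
proof -
  obtain g where g: "inverse_arrows f g"
    using i by (auto simp: is_iso_iff)
  have "x = g \<cdot> f \<cdot> x" using g x by simp
  also have "\<dots> = y" using g x by (simp add: eq)
  finally show ?thesis .
qed

lemma is_iso_comp:
  assumes "is_iso C f" "is_iso C g" "Dom C g = Cod C f"
  shows "is_iso C (g \<cdot> f)"
proof -
  obtain f' g' where f: "inverse_arrows f f'" and g: "inverse_arrows g g'"
    using assms by (auto simp: is_iso_iff)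
  note I = f[unfolded inverse_arrows_def] g[unfolded inverse_arrows_def]
  have "inverse_arrows (g \<cdot> f) (f' \<cdot> g')"
    using I assms(3) inverse_arrows_cancel(1)[OF g, of f] inverse_arrows_cancel(2)[OF f, of g']
    by (simp add: inverse_arrows_def)
  then show ?thesis
    by (auto simp: is_iso_iff)
qed

end

text \<open>
  Passing to the opposite category exchanges monads with comonads, so that the statements on
  \<open>(H, \<delta>)\<close> follow from those on \<open>(H, m)\<close>.
\<close>

definition op_cat :: "('o, 'm) cat \<Rightarrow> ('o, 'm) cat" where
  "op_cat C = C\<lparr>Dom := Cod C, Cod := Dom C, Comp := \<lambda>g f. f \<cdot>\<^bsub>C\<^esub> g\<rparr>"

lemma op_cat_simps [simp]:
  "Obj (op_cat C) = Obj C" "Arr (op_cat C) = Arr C" "Dom (op_cat C) = Cod C"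
  "Cod (op_cat C) = Dom C" "Idn (op_cat C) = Idn C" "g \<cdot>\<^bsub>op_cat C\<^esub> f = f \<cdot>\<^bsub>C\<^esub> g"
  "is_iso (op_cat C) f = is_iso C f"
  by (auto simp: op_cat_def is_iso_def hom_def)

lemma (in category) op_category: "category (op_cat C)"
  by unfold_locales (auto simp: hom_def)

section \<open>Functors and equivalences\<close>

context is_functor
begin

lemma ar_arr [simp]:
  assumes "f \<in> Arr A"
  shows "ar F f \<in> Arr B" "Dom B (ar F f) = ob F (Dom A f)" "Cod B (ar F f) = ob F (Cod A f)"
  using ar_hom[of f "Dom A f" "Cod A f"] assms by (simp_all add: hom_def)

lemma ar_comp' [simp]:
  "\<lbrakk>f \<in> Arr A; g \<in> Arr A; Dom A g = Cod A f\<rbrakk> \<Longrightarrow> ar F (g \<cdot>\<^bsub>A\<^esub> f) = ar F g \<cdot>\<^bsub>B\<^esub> ar F f"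
  by (rule ar_comp) (auto simp: hom_def)

declare ob_obj [simp] ar_idn [simp]

lemma preserves_iso: "is_iso A f \<Longrightarrow> is_iso B (ar F f)"
  unfolding A.is_iso_iff B.is_iso_iff A.inverse_arrows_def B.inverse_arrows_def
  by (metis A.cod_obj A.dom_obj ar_arr ar_comp' ar_idn)

end

context natural_transformation
begin

lemma component_arr [simp]:
  assumes "a \<in> Obj A"
  shows "t a \<in> Arr B" "Dom B (t a) = ob F a" "Cod B (t a) = ob G a"
  using component[OF assms] by (simp_all add: hom_def)

lemma natural: "\<lbrakk>f \<in> Arr A; Cod A f = b\<rbrakk> \<Longrightarrow> t b \<cdot>\<^bsub>B\<^esub> ar F f = ar G f \<cdot>\<^bsub>B\<^esub> t (Dom A f)"
  by (rule naturality) (auto simp: hom_def)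

end

lemma natural_isoI:
  assumes "natural_transformation A B F G t"
  shows "natural_iso A B F G t \<longleftrightarrow> (\<forall>a \<in> Obj A. is_iso B (t a))"
  using assms by (simp add: natural_iso_def)

lemma comp_func_simps [simp]:
  "ob (G \<circ>\<^sub>F F) a = ob G (ob F a)" "ar (G \<circ>\<^sub>F F) f = ar G (ar F f)"
  by (simp_all add: comp_func_def)

lemma id_func_simps [simp]: "ob id_func a = a" "ar id_func f = f"
  by (simp_all add: id_func_def)

lemma comp_functor:
  assumes "is_functor A B F" "is_functor B C G"
  shows "is_functor A C (G \<circ>\<^sub>F F)"
proof -
  interpret F: is_functor A B F by fact
  interpret G: is_functor B C G by fact
  show ?thesis
    by unfold_locales (auto simp: hom_def)
qed

lemma id_functor: "category A \<Longrightarrow> is_functor A A id_func"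
  by (simp add: is_functor_def is_functor_axioms_def)

definition fully_faithful ::
  "('o, 'm) cat \<Rightarrow> ('p, 'n) cat \<Rightarrow> ('o, 'm, 'p, 'n) func \<Rightarrow> bool" where
  "fully_faithful A B K \<longleftrightarrow>
     (\<forall>a \<in> Obj A. \<forall>b \<in> Obj A. bij_betw (ar K) (hom A a b) (hom B (ob K a) (ob K b)))"

definition essentially_surjective ::
  "('o, 'm) cat \<Rightarrow> ('p, 'n) cat \<Rightarrow> ('o, 'm, 'p, 'n) func \<Rightarrow> bool" where
  "essentially_surjective A B K \<longleftrightarrow>
     (\<forall>y \<in> Obj B. \<exists>a \<in> Obj A. \<exists>f \<in> hom B (ob K a) y. is_iso B f)"

lemma fully_faithful_comp:
  assumes "is_functor A B K" "fully_faithful A B K" "fully_faithful B C M"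
  shows "fully_faithful A C (M \<circ>\<^sub>F K)"
proof -
  interpret is_functor A B K by fact
  have "bij_betw (ar M \<circ> ar K) (hom A a b) (hom C (ob M (ob K a)) (ob M (ob K b)))"
    if "a \<in> Obj A" "b \<in> Obj A" for a b
    using assms that unfolding fully_faithful_def by (blast intro: bij_betw_trans ob_obj)
  then show ?thesis
    by (simp add: fully_faithful_def comp_func_def comp_def)
qed

lemma essentially_surjective_comp:
  assumes K: "is_functor A B K" "essentially_surjective A B K"
    and M: "is_functor B C M" "ob M ` Obj B = Obj C"
  shows "essentially_surjective A C (M \<circ>\<^sub>F K)"
  unfolding essentially_surjective_def
proof
  interpret M: is_functor B C M by fact
  fix z assume "z \<in> Obj C"
  then obtain y where y: "y \<in> Obj B" "z = ob M y"
    using M by blast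
  then obtain a f where "a \<in> Obj A" "f \<in> hom B (ob K a) y" "is_iso B f"
    using K unfolding essentially_surjective_def by blast
  then show "\<exists>a \<in> Obj A. \<exists>f \<in> hom C (ob (M \<circ>\<^sub>F K) a) z. is_iso C f"
    using y by (auto intro!: M.ar_hom M.preserves_iso bexI[of _ a] bexI[of _ "ar M f"])
qed

lemma equivalence_essentially_surjective:
  assumes "is_equivalence A B K"
  shows "essentially_surjective A B K"
  unfolding essentially_surjective_def
proof
  obtain L v where L: "is_functor B A L" and v: "natural_iso B B (K \<circ>\<^sub>F L) id_func v"
    using assms by (auto simp: is_equivalence_def)
  interpret L: is_functor B A L by fact
  interpret v: natural_transformation B B "K \<circ>\<^sub>F L" id_func v
    using v by (simp add: natural_iso_def)
  fix y assume "y \<in> Obj B"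
  then show "\<exists>a \<in> Obj A. \<exists>f \<in> hom B (ob K a) y. is_iso B f"
    using v.component[of y] v by (auto simp: natural_iso_def intro!: bexI[of _ "ob L y"])
qed

text \<open>
  The inverse \<open>L\<close> chooses for each \<open>y\<close> a preimage \<open>l y\<close> up to an isomorphism \<open>v y\<close>, and sends \<open>f\<close> to
  the unique arrow over \<open>v\<inverse> f v\<close>; all the laws for \<open>L\<close> and the unit follow from faithfulness of \<open>K\<close>.
\<close>

lemma equivalenceI:
  assumes K: "is_functor A B K" and ff: "fully_faithful A B K"
    and es: "essentially_surjective A B K"
  shows "is_equivalence A B K"
proof -
  interpret is_functor A B K by fact
  obtain l v w where l [simp]: "\<And>y. y \<in> Obj B \<Longrightarrow> l y \<in> Obj A"
    and v: "\<And>y. y \<in> Obj B \<Longrightarrow> v y \<in> hom B (ob K (l y)) y"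
    and vw: "\<And>y. y \<in> Obj B \<Longrightarrow> B.inverse_arrows (v y) (w y)"
    using es unfolding essentially_surjective_def B.is_iso_iff by metis
  have v_arr [simp]: "v y \<in> Arr B" "Dom B (v y) = ob K (l y)" "Cod B (v y) = y"
    "w y \<in> Arr B" "Dom B (w y) = y" "Cod B (w y) = ob K (l y)"
    "w y \<cdot>\<^bsub>B\<^esub> v y = Idn B (ob K (l y))" "v y \<cdot>\<^bsub>B\<^esub> w y = Idn B y" if "y \<in> Obj B" for y
    using v[OF that] vw[OF that] by (auto simp: hom_def B.inverse_arrows_def)
  have vw_cancel [simp]: "w y \<cdot>\<^bsub>B\<^esub> v y \<cdot>\<^bsub>B\<^esub> k = k" if "y \<in> Obj B" "k \<in> Arr B" "Cod B k = ob K (l y)"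
    for y k using B.inverse_arrows_cancel(1)[OF vw[of y]] that by simp
  have wv_cancel [simp]: "v y \<cdot>\<^bsub>B\<^esub> w y \<cdot>\<^bsub>B\<^esub> k = k" if "y \<in> Obj B" "k \<in> Arr B" "Cod B k = y"
    for y k using B.inverse_arrows_cancel(2)[OF vw[of y]] that by simp
  define lift where "lift a b g = inv_into (hom A a b) (ar K) g" for a b g
  have lift: "lift a b g \<in> hom A a b \<and> ar K (lift a b g) = g"
    if "a \<in> Obj A" "b \<in> Obj A" "g \<in> hom B (ob K a) (ob K b)" for a b g
    using that ff unfolding fully_faithful_def lift_def bij_betw_def
    by (metis inv_into_into f_inv_into_f)
  have faithful: "f = g"
    if "ar K f = ar K g" "f \<in> Arr A" "g \<in> Arr A" "Dom A f = Dom A g" "Cod A f = Cod A g" for f g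
  proof -
    have "inj_on (ar K) (hom A (Dom A f) (Cod A f))"
      using ff that by (auto simp: fully_faithful_def bij_betw_def)
    then show ?thesis
      using that by (auto simp: inj_on_def hom_def)
  qed
  define L where "L = \<lparr>ob = l, ar = \<lambda>f. lift (l (Dom B f)) (l (Cod B f))
    (w (Cod B f) \<cdot>\<^bsub>B\<^esub> f \<cdot>\<^bsub>B\<^esub> v (Dom B f))\<rparr>"
  have L [simp]: "ob L y = l y" for y
    by (simp add: L_def)
  have Lf [simp]: "ar L f \<in> Arr A" "Dom A (ar L f) = l (Dom B f)" "Cod A (ar L f) = l (Cod B f)"
    "ar K (ar L f) = w (Cod B f) \<cdot>\<^bsub>B\<^esub> f \<cdot>\<^bsub>B\<^esub> v (Dom B f)" if "f \<in> Arr B" for f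
    using lift[of "l (Dom B f)" "l (Cod B f)" "w (Cod B f) \<cdot>\<^bsub>B\<^esub> f \<cdot>\<^bsub>B\<^esub> v (Dom B f)"] that
    by (simp_all add: hom_def L_def)
  have L_functor: "is_functor B A L"
    by unfold_locales (auto simp: hom_def intro!: faithful)
  define u where "u a = lift a (l (ob K a)) (w (ob K a))" for a
  have u [simp]: "u a \<in> Arr A" "Dom A (u a) = a" "Cod A (u a) = l (ob K a)"
    "ar K (u a) = w (ob K a)" if "a \<in> Obj A" for a
    using lift[of a "l (ob K a)" "w (ob K a)"] that by (simp_all add: hom_def u_def)
  have u_iso: "is_iso A (u a)" if "a \<in> Obj A" for a
  proof -
    have "lift (l (ob K a)) a (v (ob K a)) \<in> hom A (l (ob K a)) a \<and>
        ar K (lift (l (ob K a)) a (v (ob K a))) = v (ob K a)"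
      using that by (intro lift) (simp_all add: hom_def)
    then have "A.inverse_arrows (u a) (lift (l (ob K a)) a (v (ob K a)))"
      using that by (auto simp: A.inverse_arrows_def hom_def intro!: faithful)
    then show ?thesis
      by (auto simp: A.is_iso_iff)
  qed
  interpret LK: is_functor A A "L \<circ>\<^sub>F K"
    by (rule comp_functor[OF K L_functor])
  interpret KL: is_functor B B "K \<circ>\<^sub>F L"
    by (rule comp_functor[OF L_functor K])
  interpret A1: is_functor A A id_func
    by (rule id_functor) unfold_locales
  interpret B1: is_functor B B id_func
    by (rule id_functor) unfold_locales
  have "natural_transformation A A id_func (L \<circ>\<^sub>F K) u"
    by unfold_locales (auto simp: hom_def intro!: faithful)
  moreover have "natural_transformation B B (K \<circ>\<^sub>F L) id_func v"
    by unfold_locales (auto simp: hom_def)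
  moreover have "is_iso B (v y)" if "y \<in> Obj B" for y
    using vw[OF that] by (auto simp: B.is_iso_iff)
  ultimately show ?thesis
    unfolding is_equivalence_def natural_iso_def using K L_functor u_iso by blast
qed

lemma adjunction_transpose:
  assumes adj: "is_adjunction A B L R u c" and x: "x \<in> Obj A" and y: "y \<in> Obj B"
    and g: "g \<in> hom A x (ob R y)"
  shows "c y \<cdot>\<^bsub>B\<^esub> ar L g \<in> hom B (ob L x) y"
    and "ar R (c y \<cdot>\<^bsub>B\<^esub> ar L g) \<cdot>\<^bsub>A\<^esub> u x = g"
proof -
  interpret L: is_functor A B L using adj by (simp add: is_adjunction_def)
  interpret R: is_functor B A R using adj by (simp add: is_adjunction_def)
  interpret u: natural_transformation A A id_func "R \<circ>\<^sub>F L" u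
    using adj by (simp add: is_adjunction_def)
  interpret c: natural_transformation B B "L \<circ>\<^sub>F R" id_func c
    using adj by (simp add: is_adjunction_def)
  have g' [simp]: "g \<in> Arr A" "Dom A g = x" "Cod A g = ob R y"
    using g by (auto simp: hom_def)
  show "c y \<cdot>\<^bsub>B\<^esub> ar L g \<in> hom B (ob L x) y"
    using x y by (simp add: hom_def)
  have "ar R (c y \<cdot>\<^bsub>B\<^esub> ar L g) \<cdot>\<^bsub>A\<^esub> u x = ar R (c y) \<cdot>\<^bsub>A\<^esub> u (ob R y) \<cdot>\<^bsub>A\<^esub> g"
    using x y u.natural[of g "ob R y"] by simp
  also have "\<dots> = (ar R (c y) \<cdot>\<^bsub>A\<^esub> u (ob R y)) \<cdot>\<^bsub>A\<^esub> g"
    using x y by simp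
  also have "\<dots> = g"
    using y adj by (simp add: is_adjunction_def del: L.A.assoc)
  finally show "ar R (c y \<cdot>\<^bsub>B\<^esub> ar L g) \<cdot>\<^bsub>A\<^esub> u x = g" .
qed

text \<open>
  A morphism out of \<open>L x\<close> is determined by its transpose, being \<open>c y \<circ> L (transpose)\<close>.
\<close>

lemma adjunction_eqI:
  assumes adj: "is_adjunction A B L R u c" and x: "x \<in> Obj A" and y: "y \<in> Obj B"
    and f: "f \<in> hom B (ob L x) y" and g: "g \<in> hom B (ob L x) y"
    and eq: "ar R f \<cdot>\<^bsub>A\<^esub> u x = ar R g \<cdot>\<^bsub>A\<^esub> u x"
  shows "f = g"
proof -
  interpret L: is_functor A B L using adj by (simp add: is_adjunction_def)
  interpret R: is_functor B A R using adj by (simp add: is_adjunction_def)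
  interpret u: natural_transformation A A id_func "R \<circ>\<^sub>F L" u
    using adj by (simp add: is_adjunction_def)
  interpret c: natural_transformation B B "L \<circ>\<^sub>F R" id_func c
    using adj by (simp add: is_adjunction_def)
  have triangle: "c (ob L x) \<cdot>\<^bsub>B\<^esub> ar L (u x) = Idn B (ob L x)"
    using adj x unfolding is_adjunction_def by blast
  have transpose: "c y \<cdot>\<^bsub>B\<^esub> ar L (ar R f \<cdot>\<^bsub>A\<^esub> u x) = f" if f: "f \<in> hom B (ob L x) y" for f
  proof -
    have f' [simp]: "f \<in> Arr B" "Dom B f = ob L x" "Cod B f = y"
      using f by (auto simp: hom_def)
    have "c y \<cdot>\<^bsub>B\<^esub> ar L (ar R f \<cdot>\<^bsub>A\<^esub> u x) = (c y \<cdot>\<^bsub>B\<^esub> ar L (ar R f)) \<cdot>\<^bsub>B\<^esub> ar L (u x)"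
      using x y by simp
    also have "\<dots> = f \<cdot>\<^bsub>B\<^esub> c (ob L x) \<cdot>\<^bsub>B\<^esub> ar L (u x)"
      using x y c.natural[of f y] by simp
    also have "\<dots> = f"
      by (simp add: triangle)
    finally show ?thesis .
  qed
  have "f = c y \<cdot>\<^bsub>B\<^esub> ar L (ar R f \<cdot>\<^bsub>A\<^esub> u x)"
    by (rule transpose[OF f, symmetric])
  also have "\<dots> = g"
    unfolding eq by (rule transpose[OF g])
  finally show ?thesis .
qed

section \<open>Categories of structured objects\<close>

lemma structured_cat_simps [simp]:
  "Obj (structured_cat A X U P) = X"
  "(x, f, y) \<in> Arr (structured_cat A X U P) \<longleftrightarrow> x \<in> X \<and> y \<in> X \<and> f \<in> hom A (U x) (U y) \<and> P x f y"
  "Dom (structured_cat A X U P) (x, f, y) = x"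
  "Cod (structured_cat A X U P) (x, f, y) = y"
  "Idn (structured_cat A X U P) x = (x, Idn A (U x), x)"
  "(y', g, z) \<cdot>\<^bsub>structured_cat A X U P\<^esub> (x, f, y) = (x, g \<cdot>\<^bsub>A\<^esub> f, z)"
  by (simp_all add: structured_cat_def)

lemma structured_category:
  assumes "category A" and U: "\<And>x. x \<in> X \<Longrightarrow> U x \<in> Obj A"
    and idn: "\<And>x. x \<in> X \<Longrightarrow> P x (Idn A (U x)) x"
    and comp: "\<And>x y z f g. \<lbrakk>P x f y; P y g z; x \<in> X; y \<in> X; z \<in> X; f \<in> Arr A; g \<in> Arr A;
      Dom A f = U x; Cod A f = U y; Dom A g = U y; Cod A g = U z\<rbrakk> \<Longrightarrow> P x (g \<cdot>\<^bsub>A\<^esub> f) z"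
  shows "category (structured_cat A X U P)"
proof -
  interpret category A by fact
  show ?thesis
    by unfold_locales (auto simp: hom_def U idn intro: comp)
qed

lemma structured_is_iso:
  assumes f: "(x, f, y) \<in> Arr (structured_cat A X U P)" and "category A"
    and inv: "\<And>g. \<lbrakk>category.inverse_arrows A f g; P x f y\<rbrakk> \<Longrightarrow> P y g x"
  shows "is_iso (structured_cat A X U P) (x, f, y) \<longleftrightarrow> is_iso A f"
proof -
  interpret category A by fact
  have "P y g x" if "g \<in> hom A (U y) (U x)" "g \<cdot>\<^bsub>A\<^esub> f = Idn A (U x)" "f \<cdot>\<^bsub>A\<^esub> g = Idn A (U y)" for g
    by (rule inv) (use that f in \<open>auto simp: inverse_arrows_def hom_def\<close>)
  then show ?thesis
    using f by (fastforce simp: is_iso_def hom_def)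
qed

lemma into_structured_functor:
  assumes "is_functor A B K" "category (structured_cat B X U P)"
    and "\<And>a. a \<in> Obj A \<Longrightarrow> p a \<in> X" "\<And>a. a \<in> Obj A \<Longrightarrow> U (p a) = ob K a"
    and "\<And>f. f \<in> Arr A \<Longrightarrow> P (p (Dom A f)) (ar K f) (p (Cod A f))"
  shows "is_functor A (structured_cat B X U P) (into_structured_func A p (ar K))"
proof -
  interpret K: is_functor A B K by fact
  interpret S: category "structured_cat B X U P" by fact
  show ?thesis
    by unfold_locales (auto simp: hom_def into_structured_func_def assms(3-5))
qed

lemma structured_functor:
  assumes "is_functor A B K" "category (structured_cat A X U P)" "category (structured_cat B Y V Q)"
    and "\<And>x. x \<in> X \<Longrightarrow> p x \<in> Y" "\<And>x. x \<in> X \<Longrightarrow> V (p x) = ob K (U x)" "\<And>x. x \<in> X \<Longrightarrow> U x \<in> Obj A"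
    and "\<And>x f y. (x, f, y) \<in> Arr (structured_cat A X U P) \<Longrightarrow> Q (p x) (ar K f) (p y)"
  shows "is_functor (structured_cat A X U P) (structured_cat B Y V Q) (structured_func p (ar K))"
proof -
  interpret K: is_functor A B K by fact
  interpret S: category "structured_cat A X U P" by fact
  interpret S': category "structured_cat B Y V Q" by fact
  show ?thesis
    by unfold_locales (use assms(7) in \<open>auto simp: hom_def structured_func_def assms(4-6)\<close>)
qed

lemma underlying_functor:
  assumes "category A" "category (structured_cat A X U P)" "\<And>x. x \<in> X \<Longrightarrow> U x \<in> Obj A"
  shows "is_functor (structured_cat A X U P) A (underlying_func U)"
proof -
  interpret A: category A by fact
  interpret S: category "structured_cat A X U P" by fact
  show ?thesis
    by unfold_locales (auto simp: hom_def underlying_func_def assms(3))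
qed

lemma EM_simps:
  "Obj (EM A T) = modules A T"
  "(x, f, y) \<in> Arr (EM A T) \<longleftrightarrow> x \<in> modules A T \<and> y \<in> modules A T \<and>
     f \<in> hom A (fst x) (fst y) \<and> f \<cdot>\<^bsub>A\<^esub> snd x = snd y \<cdot>\<^bsub>A\<^esub> ar (mfun T) f"
  "Dom (EM A T) (x, f, y) = x" "Cod (EM A T) (x, f, y) = y"
  "Idn (EM A T) x = (x, Idn A (fst x), x)"
  "(y', g, z) \<cdot>\<^bsub>EM A T\<^esub> (x, f, y) = (x, g \<cdot>\<^bsub>A\<^esub> f, z)"
  by (simp_all add: EM_def case_prod_unfold)

lemma coEM_simps:
  "Obj (coEM A G) = comodules A G"
  "(x, f, y) \<in> Arr (coEM A G) \<longleftrightarrow> x \<in> comodules A G \<and> y \<in> comodules A G \<and>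
     f \<in> hom A (fst x) (fst y) \<and> snd y \<cdot>\<^bsub>A\<^esub> f = ar (cfun G) f \<cdot>\<^bsub>A\<^esub> snd x"
  "Dom (coEM A G) (x, f, y) = x" "Cod (coEM A G) (x, f, y) = y"
  "Idn (coEM A G) x = (x, Idn A (fst x), x)"
  "(y', g, z) \<cdot>\<^bsub>coEM A G\<^esub> (x, f, y) = (x, g \<cdot>\<^bsub>A\<^esub> f, z)"
  by (simp_all add: coEM_def case_prod_unfold)

lemma (in category) square_comp:
  assumes "p \<cdot> g = g' \<cdot> q" "q \<cdot> f = f' \<cdot> r"
    "f \<in> Arr C" "g \<in> Arr C" "p \<in> Arr C" "q \<in> Arr C" "r \<in> Arr C" "f' \<in> Arr C" "g' \<in> Arr C"
    "Dom C p = Cod C g" "Dom C g' = Cod C q" "Dom C q = Cod C f" "Dom C f' = Cod C r"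
    "Dom C g = Cod C f"
  shows "p \<cdot> g \<cdot> f = g' \<cdot> f' \<cdot> r"
  using paste[OF assms(1), of f] assms by simp

lemma EM_category:
  assumes "is_functor A A (mfun T)"
  shows "category (EM A T)"
proof -
  interpret is_functor A A "mfun T" by fact
  show ?thesis
    unfolding EM_def
    by (rule structured_category)
      (auto simp: modules_def hom_def A.category_axioms intro!: A.paste)
qed

lemma coEM_category:
  assumes "is_functor A A (cfun G)"
  shows "category (coEM A G)"
proof -
  interpret is_functor A A "cfun G" by fact
  show ?thesis
    unfolding coEM_def
    by (rule structured_category)
      (auto simp: comodules_def hom_def A.category_axioms intro!: A.square_comp)
qed

lemma EM_is_iso:
  assumes "is_functor A A (mfun T)" and f: "(x, f, y) \<in> Arr (EM A T)"
  shows "is_iso (EM A T) (x, f, y) \<longleftrightarrow> is_iso A f"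
  using f unfolding EM_def
proof (rule structured_is_iso)
  interpret is_functor A A "mfun T" by fact
  show "category A" ..
  obtain a h b k where xy: "x = (a, h)" "y = (b, k)"
    by (metis surj_pair)
  fix g assume g: "A.inverse_arrows f g"
    and P: "(case x of (a, h) \<Rightarrow> \<lambda>f (b, k). f \<cdot>\<^bsub>A\<^esub> h = k \<cdot>\<^bsub>A\<^esub> ar (mfun T) f) f y"
  have "A.inverse_arrows (ar (mfun T) f) (ar (mfun T) g)"
    using g by (simp add: A.inverse_arrows_def flip: ar_comp')
  then have "h \<cdot>\<^bsub>A\<^esub> ar (mfun T) g = g \<cdot>\<^bsub>A\<^esub> k"
    by (rule A.inverse_arrows_swap[OF _ g])
      (use f P in \<open>auto simp: xy EM_simps modules_def hom_def\<close>)
  then show "(case y of (a, h) \<Rightarrow> \<lambda>f (b, k). f \<cdot>\<^bsub>A\<^esub> h = k \<cdot>\<^bsub>A\<^esub> ar (mfun T) f) g x"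
    by (simp add: xy)
qed

lemma coEM_is_iso:
  assumes "is_functor A A (cfun G)" and f: "(x, f, y) \<in> Arr (coEM A G)"
  shows "is_iso (coEM A G) (x, f, y) \<longleftrightarrow> is_iso A f"
  using f unfolding coEM_def
proof (rule structured_is_iso)
  interpret is_functor A A "cfun G" by fact
  show "category A" ..
  obtain a h b k where xy: "x = (a, h)" "y = (b, k)"
    by (metis surj_pair)
  fix g assume g: "A.inverse_arrows f g"
    and P: "(case x of (a, th) \<Rightarrow> \<lambda>f (b, ze). ze \<cdot>\<^bsub>A\<^esub> f = ar (cfun G) f \<cdot>\<^bsub>A\<^esub> th) f y"
  have "A.inverse_arrows (ar (cfun G) f) (ar (cfun G) g)"
    using g by (simp add: A.inverse_arrows_def flip: ar_comp')
  then have "h \<cdot>\<^bsub>A\<^esub> g = ar (cfun G) g \<cdot>\<^bsub>A\<^esub> k"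
    by (rule A.inverse_arrows_swap[OF g])
      (use f P in \<open>auto simp: xy coEM_simps comodules_def hom_def\<close>)
  then show "(case y of (a, th) \<Rightarrow> \<lambda>f (b, ze). ze \<cdot>\<^bsub>A\<^esub> f = ar (cfun G) f \<cdot>\<^bsub>A\<^esub> th) g x"
    by (simp add: xy)
qed

section \<open>Antipodes and Galois maps\<close>

text \<open>
  One endofunctor (\<open>T\<close> on objects, \<open>F\<close> on arrows) with a monad structure \<open>(m, e)\<close> and a comonad
  structure \<open>(d, n)\<close>, with no compatibility between the two: the correspondence of antipodes with
  invertible Galois maps lives at this level, and so does its duality. Naturality is oriented so that
  rewriting moves the transformations to the right, past the images of arrows.
\<close>

locale monad_comonad = category A for A :: "('o, 'm) cat" (structure) +
  fixes T :: "'o \<Rightarrow> 'o" and F :: "'m \<Rightarrow> 'm" and m e d n :: "'o \<Rightarrow> 'm"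
  assumes T_obj [simp]: "a \<in> Obj A \<Longrightarrow> T a \<in> Obj A"
    and F_arr [simp]: "f \<in> Arr A \<Longrightarrow> F f \<in> Arr A"
      "f \<in> Arr A \<Longrightarrow> Dom A (F f) = T (Dom A f)" "f \<in> Arr A \<Longrightarrow> Cod A (F f) = T (Cod A f)"
    and F_idn [simp]: "a \<in> Obj A \<Longrightarrow> F (Idn A a) = Idn A (T a)"
    and F_comp [simp]: "\<lbrakk>f \<in> Arr A; g \<in> Arr A; Dom A g = Cod A f\<rbrakk> \<Longrightarrow> F (g \<cdot> f) = F g \<cdot> F f"
    and m_arr [simp]: "a \<in> Obj A \<Longrightarrow> m a \<in> Arr A" "a \<in> Obj A \<Longrightarrow> Dom A (m a) = T (T a)"
      "a \<in> Obj A \<Longrightarrow> Cod A (m a) = T a"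
    and e_arr [simp]: "a \<in> Obj A \<Longrightarrow> e a \<in> Arr A" "a \<in> Obj A \<Longrightarrow> Dom A (e a) = a"
      "a \<in> Obj A \<Longrightarrow> Cod A (e a) = T a"
    and d_arr [simp]: "a \<in> Obj A \<Longrightarrow> d a \<in> Arr A" "a \<in> Obj A \<Longrightarrow> Dom A (d a) = T a"
      "a \<in> Obj A \<Longrightarrow> Cod A (d a) = T (T a)"
    and n_arr [simp]: "a \<in> Obj A \<Longrightarrow> n a \<in> Arr A" "a \<in> Obj A \<Longrightarrow> Dom A (n a) = T a"
      "a \<in> Obj A \<Longrightarrow> Cod A (n a) = a"
    and m_nat: "\<lbrakk>f \<in> Arr A; Cod A f = b\<rbrakk> \<Longrightarrow> m b \<cdot> F (F f) = F f \<cdot> m (Dom A f)"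
    and e_nat: "\<lbrakk>f \<in> Arr A; Cod A f = b\<rbrakk> \<Longrightarrow> e b \<cdot> f = F f \<cdot> e (Dom A f)"
    and d_nat: "\<lbrakk>f \<in> Arr A; Cod A f = b\<rbrakk> \<Longrightarrow> d b \<cdot> F f = F (F f) \<cdot> d (Dom A f)"
    and n_nat: "\<lbrakk>f \<in> Arr A; Cod A f = b\<rbrakk> \<Longrightarrow> n b \<cdot> F f = f \<cdot> n (Dom A f)"
    and m_assoc: "a \<in> Obj A \<Longrightarrow> m a \<cdot> F (m a) = m a \<cdot> m (T a)"
    and m_unit [simp]: "a \<in> Obj A \<Longrightarrow> m a \<cdot> e (T a) = Idn A (T a)"
      "a \<in> Obj A \<Longrightarrow> m a \<cdot> F (e a) = Idn A (T a)"
    and d_assoc: "a \<in> Obj A \<Longrightarrow> d (T a) \<cdot> d a = F (d a) \<cdot> d a"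
    and d_counit [simp]: "a \<in> Obj A \<Longrightarrow> n (T a) \<cdot> d a = Idn A (T a)"
      "a \<in> Obj A \<Longrightarrow> F (n a) \<cdot> d a = Idn A (T a)"
begin

lemma pasted:
  assumes "k \<in> Arr A"
  shows m_nat': "\<lbrakk>f \<in> Arr A; Cod A f = b; Cod A k = T (T (Dom A f))\<rbrakk>
      \<Longrightarrow> m b \<cdot> F (F f) \<cdot> k = F f \<cdot> m (Dom A f) \<cdot> k"
    and e_nat': "\<lbrakk>f \<in> Arr A; Cod A f = b; Cod A k = Dom A f\<rbrakk>
      \<Longrightarrow> e b \<cdot> f \<cdot> k = F f \<cdot> e (Dom A f) \<cdot> k"
    and d_nat': "\<lbrakk>f \<in> Arr A; Cod A f = b; Cod A k = T (Dom A f)\<rbrakk>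
      \<Longrightarrow> d b \<cdot> F f \<cdot> k = F (F f) \<cdot> d (Dom A f) \<cdot> k"
    and n_nat': "\<lbrakk>f \<in> Arr A; Cod A f = b; Cod A k = T (Dom A f)\<rbrakk>
      \<Longrightarrow> n b \<cdot> F f \<cdot> k = f \<cdot> n (Dom A f) \<cdot> k"
  using assms
    by (auto intro!: paste m_nat e_nat d_nat n_nat)

lemma pasted':
  assumes "k \<in> Arr A"
  shows m_unit': "\<lbrakk>a \<in> Obj A; Cod A k = T a\<rbrakk> \<Longrightarrow> m a \<cdot> e (T a) \<cdot> k = k"
      "\<lbrakk>a \<in> Obj A; Cod A k = T a\<rbrakk> \<Longrightarrow> m a \<cdot> F (e a) \<cdot> k = k"
    and d_counit': "\<lbrakk>a \<in> Obj A; Cod A k = T a\<rbrakk> \<Longrightarrow> n (T a) \<cdot> d a \<cdot> k = k"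
      "\<lbrakk>a \<in> Obj A; Cod A k = T a\<rbrakk> \<Longrightarrow> F (n a) \<cdot> d a \<cdot> k = k"
  using assms by (simp_all flip: assoc)

lemmas monad_simps = m_unit' d_counit' m_nat e_nat d_nat n_nat m_nat' e_nat' d_nat' n_nat'

lemma F_comp_eq:
  assumes "f \<cdot> g = h \<cdot> k" "f \<in> Arr A" "g \<in> Arr A" "h \<in> Arr A" "k \<in> Arr A"
    "Dom A f = Cod A g" "Dom A h = Cod A k"
  shows "F f \<cdot> F g = F h \<cdot> F k"
  using assms by (simp flip: F_comp)

lemma dual: "monad_comonad (op_cat A) T F d n m e"
proof -
  interpret op: category "op_cat A"
    by (rule op_category)
  show ?thesis
    by unfold_locales
      (auto simp: m_nat e_nat d_nat n_nat m_assoc d_assoc)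
qed

definition antipode :: "('o \<Rightarrow> 'm) \<Rightarrow> bool" where
  "antipode S \<longleftrightarrow>
     (\<forall>a \<in> Obj A. S a \<in> Arr A \<and> Dom A (S a) = T a \<and> Cod A (S a) = T a) \<and>
     (\<forall>f \<in> Arr A. S (Cod A f) \<cdot> F f = F f \<cdot> S (Dom A f)) \<and>
     (\<forall>a \<in> Obj A. m a \<cdot> F (S a) \<cdot> d a = e a \<cdot> n a \<and> m a \<cdot> S (T a) \<cdot> d a = e a \<cdot> n a)"

definition module :: "'o \<Rightarrow> 'm \<Rightarrow> bool" where
  "module a h \<longleftrightarrow> a \<in> Obj A \<and> h \<in> Arr A \<and> Dom A h = T a \<and> Cod A h = a \<and>
     h \<cdot> m a = h \<cdot> F h \<and> h \<cdot> e a = Idn A a"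

lemma free_module: "a \<in> Obj A \<Longrightarrow> module (T a) (m a)"
  by (simp add: module_def m_assoc)

text \<open>
  The inverse of the Galois map \<open>F h \<circ> d a\<close> is \<open>F h \<circ> F (S a) \<circ> d a\<close>, just as
  \<open>x \<otimes> y \<mapsto> x\<^sub>1 \<otimes> S(x\<^sub>2) y\<close> inverts \<open>x \<otimes> y \<mapsto> x\<^sub>1 \<otimes> x\<^sub>2 y\<close> for a Hopf algebra: in both
  composites, coassociativity of \<open>d\<close> and associativity of \<open>h\<close> bring one of the two antipode identities
  together.
\<close>

lemma antipode_galois:
  assumes S: "antipode S" and h: "module a h"
  shows "is_iso A (F h \<cdot> d a)"
proof -
  note [simp] = monad_simps
  have H [simp]: "a \<in> Obj A" "h \<in> Arr A" "Dom A h = T a" "Cod A h = a" "h \<cdot> e a = Idn A a"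
    and hm: "h \<cdot> F h = h \<cdot> m a"
    using h by (auto simp: module_def)
  have S_arr [simp]: "\<And>a. a \<in> Obj A \<Longrightarrow> S a \<in> Arr A" "\<And>a. a \<in> Obj A \<Longrightarrow> Dom A (S a) = T a"
      "\<And>a. a \<in> Obj A \<Longrightarrow> Cod A (S a) = T a"
    and S_nat': "S (Cod A h) \<cdot> F h = F h \<cdot> S (Dom A h)"
    and S1: "m a \<cdot> F (S a) \<cdot> d a = e a \<cdot> n a" and S2: "m a \<cdot> S (T a) \<cdot> d a = e a \<cdot> n a"
    using S H unfolding antipode_def by blast+
  have S_nat: "S a \<cdot> F h = F h \<cdot> S (T a)"
    using S_nat' by simp
  have unit: "F (h \<cdot> e a \<cdot> n a) \<cdot> d a = Idn A (T a)"
  proof -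
    have "h \<cdot> e a \<cdot> n a = (h \<cdot> e a) \<cdot> n a"
      by (rule assoc[symmetric]) simp_all
    then have "h \<cdot> e a \<cdot> n a = n a"
      by (simp del: assoc)
    then show ?thesis
      by simp
  qed
  have L: "(F h \<cdot> d a) \<cdot> F h \<cdot> F (S a) \<cdot> d a = Idn A (T a)"
  proof -
    have "(F h \<cdot> d a) \<cdot> F h \<cdot> F (S a) \<cdot> d a = F h \<cdot> F (F h) \<cdot> F (F (S a)) \<cdot> d (T a) \<cdot> d a"
      by simp
    also have "\<dots> = F ((h \<cdot> F h) \<cdot> F (S a) \<cdot> d a) \<cdot> d a"
      by (simp add: d_assoc)
    also have "\<dots> = F (h \<cdot> e a \<cdot> n a) \<cdot> d a"
      by (simp only: hm) (simp add: S1 del: F_comp)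
    finally show ?thesis using unit by simp
  qed
  have R: "(F h \<cdot> F (S a) \<cdot> d a) \<cdot> F h \<cdot> d a = Idn A (T a)"
  proof -
    have "(F h \<cdot> F (S a) \<cdot> d a) \<cdot> F h \<cdot> d a = F h \<cdot> F (S a) \<cdot> F (F h) \<cdot> d (T a) \<cdot> d a"
      by simp
    also have "\<dots> = F (h \<cdot> (S a \<cdot> F h) \<cdot> d a) \<cdot> d a"
      by (simp add: d_assoc)
    also have "\<dots> = F ((h \<cdot> F h) \<cdot> S (T a) \<cdot> d a) \<cdot> d a"
      by (simp add: S_nat)
    also have "\<dots> = F (h \<cdot> e a \<cdot> n a) \<cdot> d a"
      by (simp only: hm) (simp add: S2 del: F_comp)
    finally show ?thesis using unit by simp
  qed
  have "inverse_arrows (F h \<cdot> d a) (F h \<cdot> F (S a) \<cdot> d a)"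
    using L R by (simp add: inverse_arrows_def)
  then show ?thesis
    by (auto simp: is_iso_iff)
qed

text \<open>
  If \<open>I\<close> is the inverse of \<open>G = F m \<circ> d T\<close>, the antipode is \<open>S = n T \<circ> I \<circ> F e\<close>. As \<open>G\<close> is linear in its
  second variable and colinear in its first, so is \<open>I\<close>, which expresses \<open>I\<close> in terms of \<open>S\<close>; the
  antipode identities are \<open>G \<circ> I = 1\<close> and \<open>I \<circ> G = 1\<close>, each between \<open>n T\<close> and \<open>F e\<close>.
\<close>

lemma galois_antipode:
  assumes "\<forall>a \<in> Obj A. is_iso A (F (m a) \<cdot> d (T a))"
  shows "\<exists>S. antipode S"
proof -
  note [simp] = monad_simps
  define G where "G a = F (m a) \<cdot> d (T a)" for a
  obtain I where I: "\<And>a. a \<in> Obj A \<Longrightarrow> inverse_arrows (G a) (I a)"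
    using assms unfolding is_iso_iff G_def by metis
  have G [simp]: "G a \<in> Arr A" "Dom A (G a) = T (T a)" "Cod A (G a) = T (T a)"
    if "a \<in> Obj A" for a
    using that by (simp_all add: G_def)
  have I_arr [simp]: "I a \<in> Arr A" "Dom A (I a) = T (T a)" "Cod A (I a) = T (T a)"
    "I a \<cdot> G a = Idn A (T (T a))" "G a \<cdot> I a = Idn A (T (T a))"
    if "a \<in> Obj A" for a
    using I[OF that] that by (auto simp: inverse_arrows_def)
  have I_nat: "F (F f) \<cdot> I (Dom A f) = I (Cod A f) \<cdot> F (F f)" if "f \<in> Arr A" for f
  proof (rule inverse_arrows_swap[OF I I])
    show "G (Cod A f) \<cdot> F (F f) = F (F f) \<cdot> G (Dom A f)"
      using that by (simp add: G_def) (simp flip: F_comp assoc)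
  qed (use that in simp_all)
  have I_lin: "F (m a) \<cdot> I (T a) = I a \<cdot> F (m a)" if "a \<in> Obj A" for a
  proof (rule inverse_arrows_swap[OF I I])
    show "G a \<cdot> F (m a) = F (m a) \<cdot> G (T a)"
      using that by (simp add: G_def) (simp add: m_assoc flip: F_comp assoc)
  qed (use that in simp_all)
  have FG: "inverse_arrows (F (G a)) (F (I a))" if "a \<in> Obj A" for a
    using that by (simp add: inverse_arrows_def flip: F_comp)
  have I_colin: "d (T a) \<cdot> I a = F (I a) \<cdot> d (T a)" if "a \<in> Obj A" for a
  proof (rule inverse_arrows_swap[OF I FG])
    show "F (G a) \<cdot> d (T a) = d (T a) \<cdot> G a"
      using that by (simp add: G_def d_assoc)
  qed (use that in simp_all)
  define S where "S a = n (T a) \<cdot> I a \<cdot> F (e a)" for a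
  have S [simp]: "S a \<in> Arr A" "Dom A (S a) = T a" "Cod A (S a) = T a" if "a \<in> Obj A" for a
    using that by (simp_all add: S_def)
  have S_nat: "S (Cod A f) \<cdot> F f = F f \<cdot> S (Dom A f)" if "f \<in> Arr A" for f
  proof -
    have "S (Cod A f) \<cdot> F f = n (T (Cod A f)) \<cdot> I (Cod A f) \<cdot> F (e (Cod A f)) \<cdot> F f"
      using that by (simp add: S_def)
    also have "F (e (Cod A f)) \<cdot> F f = F (F f) \<cdot> F (e (Dom A f))"
      using that by (intro F_comp_eq e_nat) simp_all
    also have "n (T (Cod A f)) \<cdot> I (Cod A f) \<cdot> F (F f) \<cdot> F (e (Dom A f))
        = n (T (Cod A f)) \<cdot> (I (Cod A f) \<cdot> F (F f)) \<cdot> F (e (Dom A f))"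
      using that by simp
    also have "\<dots> = F f \<cdot> S (Dom A f)"
      using that by (simp add: S_def flip: I_nat)
    finally show ?thesis .
  qed
  have nI: "n (T a) \<cdot> I a = m a \<cdot> S (T a)" if "a \<in> Obj A" for a
  proof -
    have "m a \<cdot> S (T a) = n (T a) \<cdot> (F (m a) \<cdot> I (T a)) \<cdot> F (e (T a))"
      using that by (simp add: S_def)
    also have "\<dots> = n (T a) \<cdot> I a \<cdot> F (m a \<cdot> e (T a))"
      using that by (simp add: I_lin del: m_unit)
    finally show ?thesis
      using that by simp
  qed
  have I_eq: "I a = F (m a \<cdot> S (T a)) \<cdot> d (T a)" if "a \<in> Obj A" for a
  proof -
    have "I a = F (n (T a)) \<cdot> d (T a) \<cdot> I a"
      using that by simp
    also have "\<dots> = F (n (T a) \<cdot> I a) \<cdot> d (T a)"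
      using that by (simp add: I_colin)
    finally show ?thesis
      using that by (simp add: nI del: F_comp)
  qed
  have Ie: "I a \<cdot> F (e a) = F (S a) \<cdot> d a" if "a \<in> Obj A" for a
  proof -
    have "I a \<cdot> F (e a) = F (m a \<cdot> S (T a) \<cdot> F (e a)) \<cdot> d a"
      using that by (simp add: I_eq)
    also have "S (T a) \<cdot> F (e a) = F (e a) \<cdot> S a"
      using that S_nat[of "e a"] by simp
    finally show ?thesis
      using that by (simp flip: assoc)
  qed
  have "m a \<cdot> F (S a) \<cdot> d a = e a \<cdot> n a" if "a \<in> Obj A" for a
  proof -
    have nG: "n (T a) \<cdot> G a = m a"
      using that by (simp add: G_def)
    have "m a \<cdot> F (S a) \<cdot> d a = (n (T a) \<cdot> G a) \<cdot> I a \<cdot> F (e a)"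
      using that by (simp only: nG Ie)
    also have "\<dots> = n (T a) \<cdot> (G a \<cdot> I a) \<cdot> F (e a)"
      using that by (simp del: I_arr(5))
    also have "\<dots> = e a \<cdot> n a"
      using that by simp
    finally show ?thesis .
  qed
  moreover have "m a \<cdot> S (T a) \<cdot> d a = e a \<cdot> n a" if "a \<in> Obj A" for a
  proof -
    have Ge: "G a \<cdot> F (e a) = d a"
    proof -
      have "G a \<cdot> F (e a) = F (m a) \<cdot> F (F (e a)) \<cdot> d a"
        using that by (simp add: G_def)
      also have "\<dots> = F (m a \<cdot> F (e a)) \<cdot> d a"
        using that by (simp del: m_unit)
      finally show ?thesis
        using that by simp
    qed
    have "m a \<cdot> S (T a) \<cdot> d a = (n (T a) \<cdot> I a) \<cdot> d a"
      using that by (simp add: nI)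
    also have "\<dots> = n (T a) \<cdot> (I a \<cdot> G a) \<cdot> F (e a)"
      using that by (simp del: I_arr(4) flip: Ge)
    also have "\<dots> = e a \<cdot> n a"
      using that by simp
    finally show ?thesis .
  qed
  ultimately show ?thesis
    using S_nat by (intro exI[of _ S]) (auto simp: antipode_def)
qed

definition comodule :: "'o \<Rightarrow> 'm \<Rightarrow> bool" where
  "comodule a th \<longleftrightarrow> a \<in> Obj A \<and> th \<in> Arr A \<and> Dom A th = a \<and> Cod A th = T a \<and>
     d a \<cdot> th = F th \<cdot> th \<and> n a \<cdot> th = Idn A a"

lemma comodule_op: "monad_comonad.module (op_cat A) T F d n a th \<longleftrightarrow> comodule a th"
  by (auto simp: monad_comonad.module_def[OF dual] comodule_def)

lemma antipode_op: "monad_comonad.antipode (op_cat A) T F d n m e S \<longleftrightarrow> antipode S"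
  by (auto simp: monad_comonad.antipode_def[OF dual] antipode_def)

lemma antipode_iff_galois:
  "(\<exists>S. antipode S) \<longleftrightarrow> (\<forall>a \<in> Obj A. is_iso A (F (m a) \<cdot> d (T a)))"
  using antipode_galois galois_antipode free_module by blast

lemma antipode_iff_galois_module:
  "(\<exists>S. antipode S) \<longleftrightarrow> (\<forall>a h. module a h \<longrightarrow> is_iso A (F h \<cdot> d a))"
  using antipode_galois galois_antipode free_module by blast

lemma antipode_iff_cogalois:
  "(\<exists>S. antipode S) \<longleftrightarrow> (\<forall>a \<in> Obj A. is_iso A (m (T a) \<cdot> F (d a)))"
  "(\<exists>S. antipode S) \<longleftrightarrow> (\<forall>a th. comodule a th \<longrightarrow> is_iso A (m a \<cdot> F th))"
  using monad_comonad.antipode_iff_galois[OF dual] monad_comonad.antipode_iff_galois_module[OF dual]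
  by (simp_all add: antipode_op comodule_op)

end

section \<open>Bimonads arrow by arrow, and descent of bimodules\<close>

text \<open>
  The bimonad axioms in this language, with entwining \<open>l\<close>. Of the two equations for the counit on
  products, and likewise for the comultiplication on units, each implies the other by naturality, so
  that one of each is listed.
\<close>

locale bimonad_arrows = monad_comonad +
  fixes l :: "'a \<Rightarrow> 'b"
  assumes l_arr [simp]: "a \<in> Obj A \<Longrightarrow> l a \<in> Arr A" "a \<in> Obj A \<Longrightarrow> Dom A (l a) = T (T a)"
      "a \<in> Obj A \<Longrightarrow> Cod A (l a) = T (T a)"
    and l_nat: "\<lbrakk>f \<in> Arr A; Cod A f = b\<rbrakk> \<Longrightarrow> l b \<cdot> F (F f) = F (F f) \<cdot> l (Dom A f)"
    and l_e: "a \<in> Obj A \<Longrightarrow> l a \<cdot> e (T a) = F (e a)"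
    and l_n: "a \<in> Obj A \<Longrightarrow> n (T a) \<cdot> l a = F (n a)"
    and l_d: "a \<in> Obj A \<Longrightarrow> d (T a) \<cdot> l a = F (l a) \<cdot> l (T a) \<cdot> F (d a)"
    and l_m: "a \<in> Obj A \<Longrightarrow> l a \<cdot> m (T a) = F (m a) \<cdot> l (T a) \<cdot> F (l a)"
    and n_m: "a \<in> Obj A \<Longrightarrow> n a \<cdot> m a = n a \<cdot> n (T a)"
    and d_e: "a \<in> Obj A \<Longrightarrow> d a \<cdot> e a = F (e a) \<cdot> e a"
    and n_e: "a \<in> Obj A \<Longrightarrow> n a \<cdot> e a = Idn A a"
    and d_m: "a \<in> Obj A \<Longrightarrow> d a \<cdot> m a = F (m a) \<cdot> l (T a) \<cdot> F (d a)"
begin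

lemma dual_bimonad: "bimonad_arrows (op_cat A) T F d n m e l"
proof -
  interpret op: monad_comonad "op_cat A" T F d n m e
    by (rule dual)
  show ?thesis
    by unfold_locales (auto simp: l_nat l_e l_n l_d l_m n_m d_e n_e d_m e_nat n_nat)
qed

lemma l_nat':
  "\<lbrakk>f \<in> Arr A; Cod A f = b; k \<in> Arr A; Cod A k = T (T (Dom A f))\<rbrakk>
     \<Longrightarrow> l b \<cdot> F (F f) \<cdot> k = F (F f) \<cdot> l (Dom A f) \<cdot> k"
  by (intro paste l_nat) auto

text \<open>
  This identifies \<open>grouplike_tilde\<close> for the grouplike morphism \<open>e\<close> with the comultiplication. It comes
  from inserting \<open>m \<circ> F e = 1\<close> after \<open>d\<close> and expanding \<open>d \<circ> m\<close>.
\<close>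

lemma l_F_e:
  assumes a [simp]: "a \<in> Obj A"
  shows "l a \<cdot> F (e a) = d a"
proof -
  note [simp] = monad_simps
  have "d a = (d a \<cdot> m a) \<cdot> F (e a)"
    by (simp del: d_nat d_nat')
  also have "\<dots> = F (m a) \<cdot> l (T a) \<cdot> F (d a \<cdot> e a)"
    by (simp only: d_m[OF a]) simp
  also have "\<dots> = F (m a) \<cdot> (l (T a) \<cdot> F (F (e a))) \<cdot> F (e a)"
    by (simp only: d_e[OF a]) simp
  also have "\<dots> = F (m a \<cdot> F (e a)) \<cdot> l a \<cdot> F (e a)"
    by (simp add: l_nat del: m_unit)
  finally show ?thesis
    by simp
qed

lemma lift_module:
  assumes "module a h"
  shows "module (T a) (F h \<cdot> l a)"
proof -
  have H [simp]: "a \<in> Obj A" "h \<in> Arr A" "Dom A h = T a" "Cod A h = a" "h \<cdot> e a = Idn A a"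
    and hm: "h \<cdot> F h = h \<cdot> m a"
    using assms by (auto simp: module_def)
  have "F h \<cdot> l a \<cdot> m (T a) = F (h \<cdot> m a) \<cdot> l (T a) \<cdot> F (l a)"
    by (simp add: l_m)
  also have "\<dots> = F h \<cdot> l a \<cdot> F (F h) \<cdot> F (l a)"
    by (simp only: flip: hm) (simp add: l_nat')
  finally have "F h \<cdot> l a \<cdot> m (T a) = F h \<cdot> l a \<cdot> F (F h) \<cdot> F (l a)" .
  moreover have "F h \<cdot> F (e a) = Idn A (T a)"
    by (simp flip: F_comp)
  ultimately show ?thesis
    by (simp add: module_def l_e)
qed

lemma galois_module_map:
  assumes "module a h"
  shows "(F h \<cdot> d a) \<cdot> m a = (F h \<cdot> l a) \<cdot> F (F h \<cdot> d a)"
proof -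
  have H [simp]: "a \<in> Obj A" "h \<in> Arr A" "Dom A h = T a" "Cod A h = a"
    and hm: "h \<cdot> F h = h \<cdot> m a"
    using assms by (auto simp: module_def)
  have "(F h \<cdot> d a) \<cdot> m a = F (h \<cdot> m a) \<cdot> l (T a) \<cdot> F (d a)"
    by (simp add: d_m)
  also have "\<dots> = (F h \<cdot> l a) \<cdot> F (F h \<cdot> d a)"
    by (simp only: flip: hm) (simp add: l_nat')
  finally show ?thesis .
qed

text \<open>
  For \<open>f\<close> linear and colinear between objects in the image of \<open>K\<close>, linearity determines \<open>f\<close> from
  \<open>f \<circ> e a\<close>, and colinearity makes \<open>f \<circ> e a\<close> factor through \<open>e b\<close>.
\<close>

lemma K_full:
  assumes [simp]: "a \<in> Obj A" "b \<in> Obj A" "f \<in> Arr A" "Dom A f = T a" "Cod A f = T b"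
    and fm: "f \<cdot> m a = m b \<cdot> F f" and fd: "d b \<cdot> f = F f \<cdot> d a"
  shows "F (n b \<cdot> f \<cdot> e a) = f"
proof -
  note [simp] = monad_simps
  have "f \<cdot> e a = F (n b) \<cdot> (d b \<cdot> f) \<cdot> e a"
    by simp
  also have "\<dots> = F (n b) \<cdot> F f \<cdot> (d a \<cdot> e a)"
    by (simp only: fd) simp
  also have "\<dots> = F (n b \<cdot> f \<cdot> e a) \<cdot> e a"
    by (simp add: d_e)
  also have "\<dots> = e b \<cdot> n b \<cdot> f \<cdot> e a"
    by simp
  finally have fe: "f \<cdot> e a = e b \<cdot> n b \<cdot> f \<cdot> e a" .
  have "f = (f \<cdot> m a) \<cdot> F (e a)"
    by simp
  also have "\<dots> = m b \<cdot> F (f \<cdot> e a)"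
    by (simp only: fm) simp
  also have "\<dots> = m b \<cdot> F (e b) \<cdot> F (n b \<cdot> f \<cdot> e a)"
    by (subst fe) (simp del: e_nat e_nat' m_unit')
  finally show ?thesis
    by (simp add: m_unit')
qed

lemma K_faithful:
  assumes "t \<in> Arr A"
  shows "n (Cod A t) \<cdot> F t \<cdot> e (Dom A t) = t"
  using assms by (simp add: n_e n_nat')

text \<open>
  Colinear maps into the cofree bimodule on \<open>(a, h)\<close> correspond to maps into \<open>a\<close>, linear maps out of a
  free module to maps out of \<open>b\<close>; the composite correspondence takes \<open>p : b \<rightarrow> a\<close> to
  \<open>(F h \<circ> d a) \<circ> F p\<close>.
\<close>

lemma cofree_form:
  assumes h: "module a h"
    and [simp]: "b \<in> Obj A" "f \<in> Arr A" "Dom A f = T b" "Cod A f = T a"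
    and fm: "f \<cdot> m b = (F h \<cdot> l a) \<cdot> F f" and fd: "d a \<cdot> f = F f \<cdot> d b"
  shows "f = (F h \<cdot> d a) \<cdot> F (n a \<cdot> f \<cdot> e b)"
proof -
  note [simp] = monad_simps
  have H [simp]: "a \<in> Obj A" "h \<in> Arr A" "Dom A h = T a" "Cod A h = a"
    using h by (auto simp: module_def)
  have "n a \<cdot> f = n a \<cdot> (f \<cdot> m b) \<cdot> F (e b)"
    by simp
  also have "\<dots> = (n a \<cdot> F h) \<cdot> l a \<cdot> F (f \<cdot> e b)"
    by (simp only: fm) simp
  also have "\<dots> = h \<cdot> (n (T a) \<cdot> l a) \<cdot> F (f \<cdot> e b)"
    by simp
  also have "\<dots> = h \<cdot> F (n a) \<cdot> F (f \<cdot> e b)"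
    by (simp only: l_n[OF H(1)])
  finally have nf: "n a \<cdot> f = h \<cdot> F (n a \<cdot> f \<cdot> e b)"
    by simp
  have "f = F (n a) \<cdot> d a \<cdot> f"
    by simp
  also have "\<dots> = F (n a \<cdot> f) \<cdot> d b"
    by (simp only: fd) simp
  also have "\<dots> = F (h \<cdot> F (n a \<cdot> f \<cdot> e b)) \<cdot> d b"
    by (simp only: nf)
  finally show ?thesis
    by simp
qed

text \<open>
  The Galois map \<open>\<beta>\<close> of \<open>(a, h)\<close> is a bimodule map from \<open>K a\<close> to the cofree bimodule on \<open>(a, h)\<close>. If
  the latter is isomorphic to some \<open>K b\<close> through \<open>f\<close>, then \<open>f = \<beta> \<circ> F p\<close> by the correspondence above
  and \<open>f\<inverse> \<circ> \<beta> = F q\<close> because \<open>K\<close> is full. So \<open>F p \<circ> f\<inverse>\<close> is a right inverse of \<open>\<beta>\<close>, and a left one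
  because \<open>p \<circ> q = 1\<close>, which the same correspondence yields from \<open>\<beta> = \<beta> \<circ> F (p \<circ> q)\<close>.
\<close>

lemma cofree_galois:
  assumes h: "module a h" and [simp]: "b \<in> Obj A"
    and f: "is_iso A f" "Dom A f = T b" "Cod A f = T a"
    and fm: "f \<cdot> m b = (F h \<cdot> l a) \<cdot> F f" and fd: "d a \<cdot> f = F f \<cdot> d b"
  shows "is_iso A (F h \<cdot> d a)"
proof -
  note [simp] = monad_simps
  have H [simp]: "a \<in> Obj A" "h \<in> Arr A" "Dom A h = T a" "Cod A h = a" "h \<cdot> e a = Idn A a"
    using h by (auto simp: module_def)
  obtain g where g: "inverse_arrows f g"
    using f by (auto simp: is_iso_iff)
  then have fg [simp]: "f \<in> Arr A" "Dom A f = T b" "Cod A f = T a"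
     "g \<in> Arr A" "Dom A g = T a" "Cod A g = T b" "f \<cdot> g = Idn A (T a)" "g \<cdot> f = Idn A (T b)"
    using f by (auto simp: inverse_arrows_def)
  define \<beta> where "\<beta> = F h \<cdot> d a"
  have \<beta> [simp]: "\<beta> \<in> Arr A" "Dom A \<beta> = T a" "Cod A \<beta> = T a"
    by (simp_all add: \<beta>_def)
  define p where "p = n a \<cdot> f \<cdot> e b"
  have p [simp]: "p \<in> Arr A" "Dom A p = b" "Cod A p = a"
    by (simp_all add: p_def)
  have f_eq: "f = \<beta> \<cdot> F p"
    using cofree_form[OF h _ _ _ _ fm fd] by (simp add: \<beta>_def p_def)
  define q where "q = n b \<cdot> (g \<cdot> \<beta>) \<cdot> e a"
  have q [simp]: "q \<in> Arr A" "Dom A q = a" "Cod A q = b"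
    by (simp_all add: q_def)
  have gm: "m b \<cdot> F g = g \<cdot> F h \<cdot> l a"
  proof -
    have "inverse_arrows (F f) (F g)"
      by (simp add: inverse_arrows_def flip: F_comp)
    then have "m b \<cdot> F g = g \<cdot> (F h \<cdot> l a)"
      by (rule inverse_arrows_swap[OF _ g]) (simp_all add: fm)
    then show ?thesis .
  qed
  have gd: "F g \<cdot> d a = d b \<cdot> g"
  proof -
    have "inverse_arrows (F f) (F g)"
      by (simp add: inverse_arrows_def flip: F_comp)
    then show ?thesis
      by (intro inverse_arrows_swap[OF g, symmetric]) (simp_all add: fd)
  qed
  have gb: "g \<cdot> \<beta> = F q"
    unfolding q_def
  proof (rule K_full[symmetric])
    have "(g \<cdot> \<beta>) \<cdot> m a = g \<cdot> (\<beta> \<cdot> m a)"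
      by simp
    also have "\<dots> = (g \<cdot> F h \<cdot> l a) \<cdot> F \<beta>"
      using galois_module_map[OF h] by (simp add: \<beta>_def)
    also have "\<dots> = m b \<cdot> F (g \<cdot> \<beta>)"
      by (simp flip: gm)
    finally show "(g \<cdot> \<beta>) \<cdot> m a = m b \<cdot> F (g \<cdot> \<beta>)" .
    have "d b \<cdot> g \<cdot> \<beta> = (F g \<cdot> d a) \<cdot> \<beta>"
      by (simp only: gd) simp
    also have "\<dots> = F (g \<cdot> \<beta>) \<cdot> d a"
      by (simp add: \<beta>_def d_assoc)
    finally show "d b \<cdot> g \<cdot> \<beta> = F (g \<cdot> \<beta>) \<cdot> d a" .
  qed simp_all
  have "\<beta> = f \<cdot> g \<cdot> \<beta>"
    using inverse_arrows_cancel(2)[OF g, of \<beta>] by simp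
  also have "\<dots> = \<beta> \<cdot> F (p \<cdot> q)"
    by (simp only: gb) (simp add: f_eq)
  finally have \<beta>_eq: "\<beta> = \<beta> \<cdot> F (p \<cdot> q)" .
  have n\<beta>: "n a \<cdot> \<beta> = h"
    by (simp add: \<beta>_def)
  have "p \<cdot> q = h \<cdot> e a \<cdot> p \<cdot> q"
    using assoc[of "p \<cdot> q" "e a" h] by (simp del: e_nat e_nat')
  also have "\<dots> = (n a \<cdot> \<beta>) \<cdot> F (p \<cdot> q) \<cdot> e a"
    by (simp only: n\<beta>) simp
  also have "\<dots> = n a \<cdot> (\<beta> \<cdot> F (p \<cdot> q)) \<cdot> e a"
    by simp
  also have "\<dots> = (n a \<cdot> \<beta>) \<cdot> e a"
    by (simp only: flip: \<beta>_eq) simp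
  finally have pq: "p \<cdot> q = Idn A a"
    by (simp only: n\<beta>) simp
  have "inverse_arrows \<beta> (F p \<cdot> g)"
  proof -
    have "\<beta> \<cdot> F p \<cdot> g = (\<beta> \<cdot> F p) \<cdot> g"
      by simp
    also have "\<dots> = Idn A (T a)"
      by (simp flip: f_eq del: assoc)
    finally have "\<beta> \<cdot> F p \<cdot> g = Idn A (T a)" .
    moreover have "(F p \<cdot> g) \<cdot> \<beta> = F (p \<cdot> q)"
      by (simp add: gb)
    ultimately show ?thesis
      by (simp add: inverse_arrows_def pq del: F_comp)
  qed
  then show ?thesis
    by (auto simp: is_iso_iff \<beta>_def)
qed

text \<open>
  The fundamental theorem of Hopf modules. Invertibility of \<open>\<beta> = F h \<circ> d a\<close> turns the coaction \<open>th\<close> into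
  \<open>\<psi> = \<beta>\<inverse> \<circ> th\<close>, a descent datum: \<open>h \<circ> \<psi> = 1\<close>, \<open>\<psi>\<close> is linear, and \<open>F \<psi> \<circ> \<psi> = F (e a) \<circ> \<psi>\<close>.
  Then \<open>k = n a \<circ> \<psi>\<close> is idempotent, and a splitting of it through \<open>b\<close> gives the coinvariants of
  \<open>a\<close>, over which \<open>a\<close> is free: with \<open>s : b \<rightarrow> a\<close> and \<open>r : a \<rightarrow> b\<close>, the maps \<open>h \<circ> F s\<close> and \<open>F r \<circ> \<psi>\<close> are
  mutually inverse. (In terms of an antipode, \<open>k = h \<circ> S a \<circ> th\<close>.)
\<close>

lemma galois_descent:
  assumes cc: "cauchy_complete A" and h: "module a h" and th: "comodule a th"
    and lin: "th \<cdot> h = F h \<cdot> l a \<cdot> F th"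
    and iso: "is_iso A (F h \<cdot> d a)" "is_iso A (F (m a) \<cdot> d (T a))"
  shows "\<exists>b \<in> Obj A. \<exists>f. is_iso A f \<and> Dom A f = T b \<and> Cod A f = a \<and>
    f \<cdot> m b = h \<cdot> F f \<and> th \<cdot> f = F f \<cdot> d b"
proof -
  note [simp] = monad_simps
  have H [simp]: "a \<in> Obj A" "h \<in> Arr A" "Dom A h = T a" "Cod A h = a" "h \<cdot> e a = Idn A a"
    and hm: "h \<cdot> F h = h \<cdot> m a"
    using h by (auto simp: module_def)
  have th_arr [simp]: "th \<in> Arr A" "Dom A th = a" "Cod A th = T a" "n a \<cdot> th = Idn A a"
    and dth: "d a \<cdot> th = F th \<cdot> th"
    using th by (auto simp: comodule_def)
  define \<beta> where "\<beta> = F h \<cdot> d a"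
  define \<beta>' where "\<beta>' = F (m a) \<cdot> d (T a)"
  have \<beta> [simp]: "\<beta> \<in> Arr A" "Dom A \<beta> = T a" "Cod A \<beta> = T a" "n a \<cdot> \<beta> = h"
    by (simp_all add: \<beta>_def)
  have \<beta>' [simp]: "\<beta>' \<in> Arr A" "Dom A \<beta>' = T (T a)" "Cod A \<beta>' = T (T a)"
    by (simp_all add: \<beta>'_def)
  obtain \<gamma> where \<gamma>: "inverse_arrows \<beta> \<gamma>"
    using iso by (auto simp: is_iso_iff \<beta>_def)
  have \<gamma>_arr [simp]: "\<gamma> \<in> Arr A" "Dom A \<gamma> = T a" "Cod A \<gamma> = T a"
    using \<gamma> by (auto simp: inverse_arrows_def)
  define \<psi> where "\<psi> = \<gamma> \<cdot> th"
  have \<psi> [simp]: "\<psi> \<in> Arr A" "Dom A \<psi> = a" "Cod A \<psi> = T a"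
    by (simp_all add: \<psi>_def)
  have \<beta>\<psi>: "\<beta> \<cdot> \<psi> = th"
    using inverse_arrows_cancel(2)[OF \<gamma>, of th] by (simp add: \<psi>_def)
  have h\<psi>: "h \<cdot> \<psi> = Idn A a"
  proof -
    have "h \<cdot> \<psi> = n a \<cdot> \<beta> \<cdot> \<psi>"
      by (simp flip: assoc)
    then show ?thesis
      by (simp add: \<beta>\<psi>)
  qed
  have \<psi>h: "\<psi> \<cdot> h = m a \<cdot> F \<psi>"
  proof (rule is_iso_cancel)
    show "is_iso A \<beta>"
      using iso by (simp add: \<beta>_def)
    have "\<beta> \<cdot> \<psi> \<cdot> h = (\<beta> \<cdot> \<psi>) \<cdot> h"
      by simp
    also have "\<dots> = F h \<cdot> l a \<cdot> F (\<beta> \<cdot> \<psi>)"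
      by (simp only: \<beta>\<psi> lin)
    also have "\<dots> = ((F h \<cdot> l a) \<cdot> F \<beta>) \<cdot> F \<psi>"
      by simp
    also have "\<dots> = (\<beta> \<cdot> m a) \<cdot> F \<psi>"
      by (simp only: \<beta>_def galois_module_map[OF h])
    also have "\<dots> = \<beta> \<cdot> m a \<cdot> F \<psi>"
      by simp
    finally show "\<beta> \<cdot> \<psi> \<cdot> h = \<beta> \<cdot> m a \<cdot> F \<psi>" .
  qed simp_all
  have \<beta>'\<psi>: "\<beta>' \<cdot> F \<psi> = F \<psi> \<cdot> \<beta>"
  proof -
    have "\<beta>' \<cdot> F \<psi> = F (m a \<cdot> F \<psi>) \<cdot> d a"
      by (simp add: \<beta>'_def)
    then show ?thesis
      by (simp add: \<beta>_def flip: \<psi>h)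
  qed
  have \<beta>'e: "\<beta>' \<cdot> F (e a) = d a"
  proof -
    have "\<beta>' \<cdot> F (e a) = F (m a \<cdot> F (e a)) \<cdot> d a"
      by (simp add: \<beta>'_def del: m_unit)
    then show ?thesis
      by simp
  qed
  \<comment> \<open>\<open>\<beta>\<close> carries the comultiplication \<open>F e\<close> of the free-forgetful comonad to \<open>d\<close>. After composing
    with \<open>F \<beta> \<circ> \<beta>'\<close>, the equation is therefore coassociativity of \<open>th\<close>.\<close>
  have \<psi>\<psi>: "F \<psi> \<cdot> \<psi> = F (e a) \<cdot> \<psi>"
  proof (rule is_iso_cancel)
    show "is_iso A \<beta>'"
      using iso by (simp add: \<beta>'_def)
    show "\<beta>' \<cdot> F \<psi> \<cdot> \<psi> = \<beta>' \<cdot> F (e a) \<cdot> \<psi>"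
    proof (rule is_iso_cancel)
      show "is_iso A (F \<beta>)"
        using \<gamma> by (auto simp: is_iso_iff inverse_arrows_def simp flip: F_comp intro!: exI[of _ "F \<gamma>"])
      have "\<beta>' \<cdot> F \<psi> \<cdot> \<psi> = F \<psi> \<cdot> \<beta> \<cdot> \<psi>"
        using \<beta>'\<psi> by (intro paste) simp_all
      then have "F \<beta> \<cdot> \<beta>' \<cdot> F \<psi> \<cdot> \<psi> = F (\<beta> \<cdot> \<psi>) \<cdot> th"
        by (simp add: \<beta>\<psi>) (simp flip: \<beta>\<psi>)
      also have "\<dots> = d a \<cdot> \<beta> \<cdot> \<psi>"
        by (simp only: \<beta>\<psi> dth)
      also have "\<dots> = F \<beta> \<cdot> d a \<cdot> \<psi>"
        by (rule paste) (simp_all add: \<beta>_def d_assoc)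
      also have "\<dots> = F \<beta> \<cdot> (\<beta>' \<cdot> F (e a)) \<cdot> \<psi>"
        by (simp only: \<beta>'e)
      finally show "F \<beta> \<cdot> \<beta>' \<cdot> F \<psi> \<cdot> \<psi> = F \<beta> \<cdot> \<beta>' \<cdot> F (e a) \<cdot> \<psi>"
        by simp
    qed simp_all
  qed simp_all
  define k where "k = n a \<cdot> \<psi>"
  have k [simp]: "k \<in> Arr A" "Dom A k = a" "Cod A k = a"
    by (simp_all add: k_def)
  have nn\<psi>: "F k \<cdot> \<psi> = \<psi>"
  proof -
    have "F k \<cdot> \<psi> = F (n a) \<cdot> F \<psi> \<cdot> \<psi>"
      by (simp add: k_def)
    also have "\<dots> = F (n a \<cdot> e a) \<cdot> \<psi>"
      by (simp add: \<psi>\<psi> )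
    finally show ?thesis
      by (simp add: n_e)
  qed
  have \<psi>k: "\<psi> \<cdot> k = e a \<cdot> k"
  proof -
    have "\<psi> \<cdot> k = n (T a) \<cdot> F \<psi> \<cdot> \<psi>"
      by (simp add: k_def)
    also have "\<dots> = e a \<cdot> k"
      by (simp only: \<psi>\<psi>) (simp add: k_def del: e_nat e_nat')
    finally show ?thesis .
  qed
  have kk: "k \<cdot> k = k"
  proof -
    have "k \<cdot> k = n a \<cdot> \<psi> \<cdot> k"
      by (simp add: k_def)
    also have "\<dots> = (n a \<cdot> e a) \<cdot> k"
      by (simp only: \<psi>k) (simp del: e_nat e_nat')
    finally show ?thesis
      by (simp add: n_e)
  qed
  obtain b r s where b [simp]: "b \<in> Obj A" and "r \<in> hom A a b" "s \<in> hom A b a"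
    and sr: "s \<cdot> r = k" and rs: "r \<cdot> s = Idn A b"
    using cc kk homI[OF k] \<open>a \<in> Obj A\<close> unfolding cauchy_complete_def by metis
  then have rs_arr [simp]: "r \<in> Arr A" "Dom A r = a" "Cod A r = b"
    "s \<in> Arr A" "Dom A s = b" "Cod A s = a"
    by (auto simp: hom_def)
  have ks: "k \<cdot> s = s"
    by (simp add: rs flip: sr)
  have \<psi>s: "\<psi> \<cdot> s = e a \<cdot> s"
  proof -
    have "\<psi> \<cdot> s = (\<psi> \<cdot> k) \<cdot> s"
      by (simp add: ks)
    also have "\<dots> = e a \<cdot> k \<cdot> s"
      by (simp only: \<psi>k) (simp del: e_nat e_nat')
    finally show ?thesis
      by (simp only: ks)
  qed
  define f where "f = h \<cdot> F s"
  have f [simp]: "f \<in> Arr A" "Dom A f = T b" "Cod A f = a"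
    by (simp_all add: f_def)
  have \<psi>f: "\<psi> \<cdot> f = F s"
  proof -
    have "\<psi> \<cdot> f = (\<psi> \<cdot> h) \<cdot> F s"
      by (simp add: f_def)
    also have "\<dots> = m a \<cdot> F (\<psi> \<cdot> s)"
      by (simp only: \<psi>h) simp
    also have "\<dots> = m a \<cdot> F (e a) \<cdot> F s"
      by (simp only: \<psi>s) (simp del: e_nat e_nat' m_unit')
    finally show ?thesis
      by (simp add: m_unit')
  qed
  have "inverse_arrows f (F r \<cdot> \<psi>)"
  proof -
    have "f \<cdot> F r \<cdot> \<psi> = h \<cdot> F (s \<cdot> r) \<cdot> \<psi>"
      by (simp add: f_def)
    also have "\<dots> = Idn A a"
      by (simp only: sr nn\<psi> h\<psi>)
    finally have "f \<cdot> F r \<cdot> \<psi> = Idn A a" .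
    moreover have "(F r \<cdot> \<psi>) \<cdot> f = F (r \<cdot> s)"
      by (simp add: \<psi>f)
    ultimately show ?thesis
      by (simp add: inverse_arrows_def rs)
  qed
  then have "is_iso A f"
    by (auto simp: is_iso_iff)
  moreover have "f \<cdot> m b = h \<cdot> F f"
  proof -
    have "f \<cdot> m b = (h \<cdot> m a) \<cdot> F (F s)"
      by (simp add: f_def)
    also have "\<dots> = h \<cdot> F f"
      by (simp only: flip: hm) (simp add: f_def)
    finally show ?thesis .
  qed
  moreover have "th \<cdot> f = F f \<cdot> d b"
  proof -
    have "th \<cdot> f = \<beta> \<cdot> \<psi> \<cdot> f"
      by (simp flip: \<beta>\<psi>)
    also have "\<dots> = F f \<cdot> d b"
      by (simp only: \<psi>f) (simp add: \<beta>_def f_def)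
    finally show ?thesis .
  qed
  ultimately show ?thesis
    using b f by blast
qed

end

section \<open>The Galois conditions in terms of arrows\<close>

lemma parts_simps [simp]:
  "mfun (monad_part H) = bfun H" "mult (monad_part H) = bmult H" "unit (monad_part H) = bunit H"
  "cfun (comonad_part H) = bfun H" "comult (comonad_part H) = bcomult H"
  "counit (comonad_part H) = bcounit H"
  by (simp_all add: monad_part_def comonad_part_def)

sublocale bimonad \<subseteq> H: is_functor A A "bfun H"
  using T.functor_T by simp

sublocale bimonad \<subseteq> bimonad_arrows A "ob (bfun H)" "ar (bfun H)" "bmult H" "bunit H" "bcomult H"
  "bcounit H" "bentw H"
proof -
  interpret m: natural_transformation A A "bfun H \<circ>\<^sub>F bfun H" "bfun H" "bmult H"
    using T.mult_nat by simp
  interpret e: natural_transformation A A id_func "bfun H" "bunit H"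
    using T.unit_nat by simp
  interpret d: natural_transformation A A "bfun H" "bfun H \<circ>\<^sub>F bfun H" "bcomult H"
    using G.comult_nat by simp
  interpret n: natural_transformation A A "bfun H" id_func "bcounit H"
    using G.counit_nat by simp
  interpret l: natural_transformation A A "bfun H \<circ>\<^sub>F bfun H" "bfun H \<circ>\<^sub>F bfun H" "bentw H"
    using lam_nat by simp
  show "bimonad_arrows A (ob (bfun H)) (ar (bfun H)) (bmult H) (bunit H) (bcomult H)
    (bcounit H) (bentw H)"
    by unfold_locales
      (auto simp: m.natural[simplified] e.natural[simplified] d.natural[simplified]
        n.natural[simplified] l.natural[simplified] T.mult_assoc[simplified]
        T.mult_unit_left[simplified] T.mult_unit_right[simplified] G.comult_coassoc[simplified]
        G.comult_counit_left[simplified] G.comult_counit_right[simplified]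
        lam_unit[simplified] lam_counit[simplified] lam_comult[simplified] lam_mult[simplified]
        counit_mult_1 comult_unit_2 counit_unit comult_mult)
qed

context bimonad
begin

abbreviation "T \<equiv> ob (bfun H)"
abbreviation "F \<equiv> ar (bfun H)"
abbreviation "m \<equiv> bmult H"
abbreviation "e \<equiv> bunit H"
abbreviation "d \<equiv> bcomult H"
abbreviation "n \<equiv> bcounit H"
abbreviation "l \<equiv> bentw H"
abbreviation "EMH \<equiv> EM A (monad_part H)"
abbreviation "coEMH \<equiv> coEM A (comonad_part H)"

lemma modules_iff [simp]: "(a, h) \<in> modules A (monad_part H) \<longleftrightarrow> module a h"
  by (auto simp: modules_def module_def hom_def)

lemma comodules_iff [simp]: "(a, th) \<in> comodules A (comonad_part H) \<longleftrightarrow> comodule a th"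
  by (auto simp: comodules_def comodule_def hom_def)

lemma modules_ball:
  "(\<forall>x \<in> modules A (monad_part H). P x) \<longleftrightarrow> (\<forall>a h. module a h \<longrightarrow> P (a, h))"
  by auto

lemma comodules_ball:
  "(\<forall>x \<in> comodules A (comonad_part H). P x) \<longleftrightarrow> (\<forall>a th. comodule a th \<longrightarrow> P (a, th))"
  by auto

lemma module_arr:
  assumes "module a h"
  shows "a \<in> Obj A" "h \<in> Arr A" "Dom A h = T a" "Cod A h = a"
  using assms by (auto simp: module_def)

lemma comodule_arr:
  assumes "comodule a th"
  shows "a \<in> Obj A" "th \<in> Arr A" "Dom A th = a" "Cod A th = T a"
  using assms by (auto simp: comodule_def)

lemma cofree_comodule: "a \<in> Obj A \<Longrightarrow> comodule (T a) (d a)"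
  by (simp add: comodule_def d_assoc)

lemma lift_comodule: "comodule a th \<Longrightarrow> comodule (T a) (l a \<cdot> F th)"
  using bimonad_arrows.lift_module[OF dual_bimonad] by (simp add: comodule_op)

lemma cogalois_comodule_map:
  "comodule a th \<Longrightarrow> d a \<cdot> m a \<cdot> F th = F (m a \<cdot> F th) \<cdot> l a \<cdot> F th"
  using bimonad_arrows.galois_module_map[OF dual_bimonad, of a th] by (simp add: comodule_op)

sublocale EM: category EMH
  by (rule EM_category) (simp add: H.is_functor_axioms)

sublocale coEM: category coEMH
  by (rule coEM_category) (simp add: H.is_functor_axioms)

lemma EMH_is_iso:
  "(x, f, y) \<in> Arr EMH \<Longrightarrow> is_iso EMH (x, f, y) \<longleftrightarrow> is_iso A f"
  by (rule EM_is_iso) (simp add: H.is_functor_axioms)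

lemma coEMH_is_iso:
  "(x, f, y) \<in> Arr coEMH \<Longrightarrow> is_iso coEMH (x, f, y) \<longleftrightarrow> is_iso A f"
  by (rule coEM_is_iso) (simp add: H.is_functor_axioms)

lemma hat_comonad_simps [simp]:
  "ob (cfun (bimonad_hat_comonad A H)) (a, h) = (T a, F h \<cdot> l a)"
  "ar (cfun (bimonad_hat_comonad A H)) (x, f, y) =
    (ob (cfun (bimonad_hat_comonad A H)) x, F f, ob (cfun (bimonad_hat_comonad A H)) y)"
  by (simp_all add: bimonad_hat_comonad_def hat_comonad_def structured_func_def Let_def)

lemma hat_monad_simps [simp]:
  "ob (mfun (bimonad_hat_monad A H)) (a, th) = (T a, l a \<cdot> F th)"
  "ar (mfun (bimonad_hat_monad A H)) (x, f, y) =
    (ob (mfun (bimonad_hat_monad A H)) x, F f, ob (mfun (bimonad_hat_monad A H)) y)"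
  by (simp_all add: bimonad_hat_monad_def hat_monad_def structured_func_def Let_def)

lemma square_F:
  assumes "f \<cdot> g = h \<cdot> k" "f \<in> Arr A" "g \<in> Arr A" "h \<in> Arr A" "k \<in> Arr A" "c \<in> Arr A"
    "Dom A f = Cod A g" "Dom A h = Cod A k" "T (Dom A g) = Cod A c" "T (Dom A k) = Cod A c"
  shows "F f \<cdot> F g \<cdot> c = F h \<cdot> F k \<cdot> c"
  using assms by (intro T.paste F_comp_eq) simp_all

lemma hat_comonad_functor: "is_functor EMH EMH (cfun (bimonad_hat_comonad A H))"
proof -
  have eq: "cfun (bimonad_hat_comonad A H) = structured_func (\<lambda>(a, h). (T a, F h \<cdot> l a)) F"
    by (simp add: bimonad_hat_comonad_def hat_comonad_def Let_def)
  have map: "F f \<cdot> F h \<cdot> l a = (F k \<cdot> l b) \<cdot> F (F f)"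
    if "module a h" "module b k" "f \<in> hom A a b" "f \<cdot> h = k \<cdot> F f" for a h b k f
    using that(3,4) module_arr[OF that(1)] module_arr[OF that(2)]
    by (auto simp: hom_def l_nat intro!: square_F)
  show ?thesis
    unfolding EM_def eq
    by (rule structured_functor)
      (use EM.category_axioms[unfolded EM_def] map in
        \<open>auto simp: H.is_functor_axioms lift_module simp del: T.assoc dest: module_arr\<close>)
qed

lemma hat_monad_functor: "is_functor coEMH coEMH (mfun (bimonad_hat_monad A H))"
proof -
  have eq: "mfun (bimonad_hat_monad A H) = structured_func (\<lambda>(a, h). (T a, l a \<cdot> F h)) F"
    by (simp add: bimonad_hat_monad_def hat_monad_def Let_def)
  have map: "(l b \<cdot> F k) \<cdot> F f = F (F f) \<cdot> l a \<cdot> F h"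
    if "comodule a h" "comodule b k" "f \<in> hom A a b" "k \<cdot> f = F f \<cdot> h" for a h b k f
  proof -
    note [simp] = comodule_arr[OF that(1)] comodule_arr[OF that(2)]
    have f [simp]: "f \<in> Arr A" "Dom A f = a" "Cod A f = b"
      using that(3) by (auto simp: hom_def)
    have "(l b \<cdot> F k) \<cdot> F f = l b \<cdot> F (F f) \<cdot> F h"
      using F_comp_eq[OF that(4)] by simp
    also have "\<dots> = F (F f) \<cdot> l a \<cdot> F h"
      by (simp add: l_nat')
    finally show ?thesis .
  qed
  show ?thesis
    unfolding coEM_def eq
    by (rule structured_functor)
      (use coEM.category_axioms[unfolded coEM_def] map in
        \<open>auto simp: H.is_functor_axioms lift_comodule simp del: T.assoc dest: comodule_arr\<close>)
qed

lemma free_functor: "is_functor A EMH (free A (monad_part H))"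
  using EM.category_axioms unfolding EM_def free_def parts_simps
  by (intro into_structured_functor H.is_functor_axioms)
    (auto simp: free_module m_nat)

lemma cofree_functor: "is_functor A coEMH (cofree A (comonad_part H))"
  using coEM.category_axioms unfolding coEM_def cofree_def parts_simps
  by (intro into_structured_functor H.is_functor_axioms)
    (auto simp: cofree_comodule d_nat)

lemma forget_EM: "is_functor EMH A forget"
  using EM.category_axioms unfolding EM_def forget_def
  by (intro underlying_functor T.category_axioms) (auto dest: module_arr comodule_arr)

lemma forget_coEM: "is_functor coEMH A forget"
  using coEM.category_axioms unfolding coEM_def forget_def
  by (intro underlying_functor T.category_axioms) (auto dest: module_arr comodule_arr)

lemma functor_simps [simp]:
  "ob (free A (monad_part H)) a = (T a, m a)"
  "ar (free A (monad_part H)) f = ((T (Dom A f), m (Dom A f)), F f, (T (Cod A f), m (Cod A f)))"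
  "ob (cofree A (comonad_part H)) a = (T a, d a)"
  "ar (cofree A (comonad_part H)) f = ((T (Dom A f), d (Dom A f)), F f, (T (Cod A f), d (Cod A f)))"
  "ob forget x = fst x" "ar forget (x, f, y) = f"
  by (simp_all add: free_def cofree_def into_structured_func_def forget_def underlying_func_def)

text \<open>
  At the module \<open>(a, h)\<close>, the Galois transformation has underlying arrow \<open>F h \<circ> d a\<close>.
\<close>

lemma free_galois_iff:
  "comodule_functor_galois EMH (free A (monad_part H)) forget (EM_counit A (monad_part H))
     (bimonad_hat_comonad A H) (alpha_K_monad A H)
   \<longleftrightarrow> (\<forall>a h. module a h \<longrightarrow> is_iso A (F h \<cdot> d a))"
proof -
  let ?G = "cfun (bimonad_hat_comonad A H)"
  interpret FU: is_functor EMH EMH "free A (monad_part H) \<circ>\<^sub>F forget"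
    by (rule comp_functor[OF forget_EM free_functor])
  interpret G: is_functor EMH EMH ?G
    by (rule hat_comonad_functor)
  let ?\<beta> = "\<lambda>x. ar ?G (EM_counit A (monad_part H) x) \<cdot>\<^bsub>EMH\<^esub> alpha_K_monad A H (ob forget x)"
  have \<beta>: "ar ?G (EM_counit A (monad_part H) (a, h)) \<cdot>\<^bsub>EMH\<^esub> alpha_K_monad A H a =
      ((T a, m a), F h \<cdot> d a, (T a, F h \<cdot> l a))" for a h
    by (simp add: EM_counit_def alpha_K_monad_def EM_simps)
  have arr: "((T a, m a), F h \<cdot> d a, (T a, F h \<cdot> l a)) \<in> Arr EMH" if "module a h" for a h
    using module_arr[OF that] galois_module_map[OF that] that
    by (simp add: EM_simps free_module lift_module hom_def)
  have nat: "(F k \<cdot> d b) \<cdot> F f = F f \<cdot> F h \<cdot> d a"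
    if "module a h" "module b k" "f \<in> hom A a b" "f \<cdot> h = k \<cdot> F f" for a h b k f
    using that(3,4) module_arr[OF that(1)] module_arr[OF that(2)]
    by (auto simp: hom_def d_nat intro!: square_F[symmetric])
  have "natural_transformation EMH EMH (free A (monad_part H) \<circ>\<^sub>F forget) ?G ?\<beta>"
  proof unfold_locales
    fix x assume "x \<in> Obj EMH"
    then show "?\<beta> x \<in> hom EMH (ob (free A (monad_part H) \<circ>\<^sub>F forget) x) (ob ?G x)"
      using arr by (cases x) (simp add: hom_def EM_simps \<beta>)
  next
    fix g x y assume g: "g \<in> hom EMH x y"
    obtain a h b k f where eq: "g = ((a, h), f, (b, k))"
      by (metis surj_pair)
    then show "?\<beta> y \<cdot>\<^bsub>EMH\<^esub> ar (free A (monad_part H) \<circ>\<^sub>F forget) g = ar ?G g \<cdot>\<^bsub>EMH\<^esub> ?\<beta> x"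
      using g nat[of a h b k f] by (auto simp: hom_def EM_simps \<beta> simp del: T.assoc dest: module_arr)
  qed
  then show ?thesis
    unfolding comodule_functor_galois_def
    by (subst natural_isoI) (simp_all add: \<beta> EM_simps(1) EMH_is_iso arr modules_ball)
qed

text \<open>
  At the comodule \<open>(a, th)\<close>, the Galois transformation has underlying arrow \<open>m a \<circ> F th\<close>.
\<close>

lemma cofree_galois_iff:
  "module_functor_galois coEMH (cofree A (comonad_part H)) forget (coEM_unit A (comonad_part H))
     (bimonad_hat_monad A H) (alpha_K_comonad A H)
   \<longleftrightarrow> (\<forall>a th. comodule a th \<longrightarrow> is_iso A (m a \<cdot> F th))"
proof -
  let ?T = "mfun (bimonad_hat_monad A H)"
  interpret RU: is_functor coEMH coEMH "cofree A (comonad_part H) \<circ>\<^sub>F forget"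
    by (rule comp_functor[OF forget_coEM cofree_functor])
  interpret T': is_functor coEMH coEMH ?T
    by (rule hat_monad_functor)
  let ?\<beta> = "\<lambda>x. alpha_K_comonad A H (ob forget x) \<cdot>\<^bsub>coEMH\<^esub> ar ?T (coEM_unit A (comonad_part H) x)"
  have \<beta>: "alpha_K_comonad A H a \<cdot>\<^bsub>coEMH\<^esub> ar ?T (coEM_unit A (comonad_part H) (a, th)) =
      ((T a, l a \<cdot> F th), m a \<cdot> F th, (T a, d a))" for a th
    by (simp add: coEM_unit_def alpha_K_comonad_def coEM_simps)
  have arr: "((T a, l a \<cdot> F th), m a \<cdot> F th, (T a, d a)) \<in> Arr coEMH" if "comodule a th" for a th
    using comodule_arr[OF that] cogalois_comodule_map[OF that] that
    by (simp add: coEM_simps cofree_comodule lift_comodule hom_def)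
  have nat: "(m b \<cdot> F k) \<cdot> F f = F f \<cdot> m a \<cdot> F h"
    if "comodule a h" "comodule b k" "f \<in> hom A a b" "k \<cdot> f = F f \<cdot> h" for a h b k f
  proof -
    note [simp] = comodule_arr[OF that(1)] comodule_arr[OF that(2)]
    have f [simp]: "f \<in> Arr A" "Dom A f = a" "Cod A f = b"
      using that(3) by (auto simp: hom_def)
    have "(m b \<cdot> F k) \<cdot> F f = m b \<cdot> F (F f) \<cdot> F h"
      using F_comp_eq[OF that(4)] by simp
    also have "\<dots> = F f \<cdot> m a \<cdot> F h"
      by (simp add: m_nat')
    finally show ?thesis .
  qed
  have "natural_transformation coEMH coEMH ?T (cofree A (comonad_part H) \<circ>\<^sub>F forget) ?\<beta>"
  proof unfold_locales
    fix x assume "x \<in> Obj coEMH"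
    then show "?\<beta> x \<in> hom coEMH (ob ?T x) (ob (cofree A (comonad_part H) \<circ>\<^sub>F forget) x)"
      using arr by (cases x) (simp add: hom_def coEM_simps \<beta>)
  next
    fix g x y assume g: "g \<in> hom coEMH x y"
    obtain a h b k f where eq: "g = ((a, h), f, (b, k))"
      by (metis surj_pair)
    then show "?\<beta> y \<cdot>\<^bsub>coEMH\<^esub> ar ?T g =
        ar (cofree A (comonad_part H) \<circ>\<^sub>F forget) g \<cdot>\<^bsub>coEMH\<^esub> ?\<beta> x"
      using g nat[of a h b k f] by (auto simp: hom_def coEM_simps \<beta> simp del: T.assoc dest: comodule_arr)
  qed
  then show ?thesis
    unfolding module_functor_galois_def
    by (subst natural_isoI) (simp_all add: \<beta> coEM_simps(1) coEMH_is_iso arr comodules_ball)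
qed

lemma natural_endo_isoI:
  assumes "\<And>a. a \<in> Obj A \<Longrightarrow> t a \<in> Arr A \<and> Dom A (t a) = T (T a) \<and> Cod A (t a) = T (T a)"
    and "\<And>f. f \<in> Arr A \<Longrightarrow> t (Cod A f) \<cdot> F (F f) = F (F f) \<cdot> t (Dom A f)"
  shows "natural_iso A A (bfun H \<circ>\<^sub>F bfun H) (bfun H \<circ>\<^sub>F bfun H) t
    \<longleftrightarrow> (\<forall>a \<in> Obj A. is_iso A (t a))"
proof (rule natural_isoI)
  interpret HH: is_functor A A "bfun H \<circ>\<^sub>F bfun H"
    by (rule comp_functor) (rule H.is_functor_axioms)+
  show "natural_transformation A A (bfun H \<circ>\<^sub>F bfun H) (bfun H \<circ>\<^sub>F bfun H) t"
    by unfold_locales (use assms in \<open>auto simp: hom_def\<close>)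
qed

lemma galois_iff:
  "natural_iso A A (bfun H \<circ>\<^sub>F bfun H) (bfun H \<circ>\<^sub>F bfun H) (\<lambda>a. F (m a) \<cdot> d (T a))
   \<longleftrightarrow> (\<forall>a \<in> Obj A. is_iso A (F (m a) \<cdot> d (T a)))"
proof (rule natural_endo_isoI)
  fix f assume f: "f \<in> Arr A"
  have "F (m (Cod A f)) \<cdot> F (F (F f)) \<cdot> d (T (Dom A f)) =
      F (F f) \<cdot> F (m (Dom A f)) \<cdot> d (T (Dom A f))"
    using f by (intro square_F m_nat) simp_all
  then show "(F (m (Cod A f)) \<cdot> d (T (Cod A f))) \<cdot> F (F f) =
      F (F f) \<cdot> F (m (Dom A f)) \<cdot> d (T (Dom A f))"
    using f by (simp add: d_nat)
qed simp

lemma cogalois_iff: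
  "natural_iso A A (bfun H \<circ>\<^sub>F bfun H) (bfun H \<circ>\<^sub>F bfun H) (\<lambda>a. m (T a) \<cdot> F (d a))
   \<longleftrightarrow> (\<forall>a \<in> Obj A. is_iso A (m (T a) \<cdot> F (d a)))"
proof (rule natural_endo_isoI)
  fix f assume f: "f \<in> Arr A"
  have "F (d (Cod A f)) \<cdot> F (F f) = F (F (F f)) \<cdot> F (d (Dom A f))"
    using f by (intro F_comp_eq d_nat) simp_all
  then show "(m (T (Cod A f)) \<cdot> F (d (Cod A f))) \<cdot> F (F f) =
      F (F f) \<cdot> m (T (Dom A f)) \<cdot> F (d (Dom A f))"
    using f by (simp add: m_nat')
qed simp

lemma antipode_iff: "is_antipode A H S \<longleftrightarrow> antipode S"
proof
  assume S: "is_antipode A H S"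
  then interpret S: natural_transformation A A "bfun H" "bfun H" S
    by (simp add: is_antipode_def)
  show "antipode S"
    using S by (simp add: antipode_def is_antipode_def S.natural)
next
  assume S: "antipode S"
  then have "natural_transformation A A (bfun H) (bfun H) S"
    by unfold_locales (auto simp: antipode_def hom_def)
  then show "is_antipode A H S"
    using S by (simp add: antipode_def is_antipode_def)
qed

section \<open>Bimodules and the comparison functor\<close>

definition bimodule :: "'o \<Rightarrow> 'm \<Rightarrow> 'm \<Rightarrow> bool" where
  "bimodule a h th \<longleftrightarrow> module a h \<and> comodule a th \<and> th \<cdot> h = F h \<cdot> l a \<cdot> F th"

lemma bimodule_arr:
  assumes "bimodule a h th"
  shows "a \<in> Obj A" "h \<in> Arr A" "Dom A h = T a" "Cod A h = a"
    "th \<in> Arr A" "Dom A th = a" "Cod A th = T a"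
  using assms by (auto simp: bimodule_def dest: module_arr comodule_arr)

lemma bimodule_cat_simps:
  "(a, h, th) \<in> Obj (bimodule_cat A H) \<longleftrightarrow> bimodule a h th"
  "((a, h, th), f, (b, k, ze)) \<in> Arr (bimodule_cat A H) \<longleftrightarrow> bimodule a h th \<and> bimodule b k ze \<and>
     f \<in> hom A a b \<and> f \<cdot> h = k \<cdot> F f \<and> ze \<cdot> f = F f \<cdot> th"
  "Dom (bimodule_cat A H) (x, f, y) = x" "Cod (bimodule_cat A H) (x, f, y) = y"
  "Idn (bimodule_cat A H) x = (x, Idn A (fst x), x)"
  "(y', g, z) \<cdot>\<^bsub>bimodule_cat A H\<^esub> (x, f, y) = (x, g \<cdot> f, z)"
  by (simp_all add: bimodule_cat_def mixed_cat_def bimodule_def)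

lemma bimodule_category: "category (bimodule_cat A H)"
  unfolding bimodule_cat_def mixed_cat_def
  by (rule structured_category)
    (auto simp: T.category_axioms module_def comodule_def intro!: T.paste T.square_comp)

lemma bimodule_is_iso:
  assumes f: "((a, h, th), f, (b, k, ze)) \<in> Arr (bimodule_cat A H)"
  shows "is_iso (bimodule_cat A H) ((a, h, th), f, (b, k, ze)) \<longleftrightarrow> is_iso A f"
  using f unfolding bimodule_cat_def mixed_cat_def
proof (rule structured_is_iso)
  fix g assume g: "T.inverse_arrows f g"
    and P: "(case (a, h, th) of (a, h, th) \<Rightarrow> \<lambda>f (b, k, ze).
      f \<cdot> h = k \<cdot> ar (mfun (monad_part H)) f \<and> ze \<cdot> f = ar (cfun (comonad_part H)) f \<cdot> th) f (b, k, ze)"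
  have fg: "bimodule a h th" "bimodule b k ze" "f \<in> hom A a b"
    using f by (simp_all add: bimodule_cat_simps)
  have F: "T.inverse_arrows (F f) (F g)"
    using g by (simp add: T.inverse_arrows_def flip: F_comp)
  have "h \<cdot> F g = g \<cdot> k"
    by (rule T.inverse_arrows_swap[OF F g])
      (use fg P in \<open>auto simp: hom_def bimodule_arr\<close>)
  moreover have "th \<cdot> g = F g \<cdot> ze"
    by (rule T.inverse_arrows_swap[OF g F])
      (use fg P in \<open>auto simp: hom_def bimodule_arr\<close>)
  ultimately show "(case (b, k, ze) of (a, h, th) \<Rightarrow> \<lambda>f (b, k, ze).
      f \<cdot> h = k \<cdot> ar (mfun (monad_part H)) f \<and> ze \<cdot> f = ar (cfun (comonad_part H)) f \<cdot> th) g (a, h, th)"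
    by simp
qed (rule T.category_axioms)

lemma K_simps [simp]:
  "ob (K_bimod A H) a = (T a, m a, d a)"
  "ar (K_bimod A H) f =
    ((T (Dom A f), m (Dom A f), d (Dom A f)), F f, (T (Cod A f), m (Cod A f), d (Cod A f)))"
  by (simp_all add: K_bimod_def into_structured_func_def)

lemma K_bimodule: "a \<in> Obj A \<Longrightarrow> bimodule (T a) (m a) (d a)"
  by (simp add: bimodule_def free_module cofree_comodule d_m)

lemma K_functor: "is_functor A (bimodule_cat A H) (K_bimod A H)"
  using bimodule_category unfolding bimodule_cat_def mixed_cat_def K_bimod_def
  by (intro into_structured_functor H.is_functor_axioms)
    (auto simp: free_module cofree_comodule d_m m_nat d_nat)

lemma K_fully_faithful: "fully_faithful A (bimodule_cat A H) (K_bimod A H)"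
  unfolding fully_faithful_def
proof (intro ballI, rule bij_betw_imageI)
  interpret K: is_functor A "bimodule_cat A H" "K_bimod A H"
    by (rule K_functor)
  fix a b assume ab: "a \<in> Obj A" "b \<in> Obj A"
  show "inj_on (ar (K_bimod A H)) (hom A a b)"
  proof (rule inj_onI)
    fix s t assume "s \<in> hom A a b" "t \<in> hom A a b" "ar (K_bimod A H) s = ar (K_bimod A H) t"
    then show "s = t"
      using K_faithful[of s] K_faithful[of t] by (simp add: hom_def)
  qed
  show "ar (K_bimod A H) ` hom A a b = hom (bimodule_cat A H) (ob (K_bimod A H) a) (ob (K_bimod A H) b)"
  proof (intro subset_antisym image_subsetI K.ar_hom)
    show "hom (bimodule_cat A H) (ob (K_bimod A H) a) (ob (K_bimod A H) b)
      \<subseteq> ar (K_bimod A H) ` hom A a b"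
    proof
      fix g assume g: "g \<in> hom (bimodule_cat A H) (ob (K_bimod A H) a) (ob (K_bimod A H) b)"
      then obtain f where gf: "g = ((T a, m a, d a), f, (T b, m b, d b))"
        by (cases g) (auto simp: hom_def bimodule_cat_simps)
      have f: "f \<in> Arr A" "Dom A f = T a" "Cod A f = T b" "f \<cdot> m a = m b \<cdot> F f" "d b \<cdot> f = F f \<cdot> d a"
        using g by (auto simp: gf hom_def bimodule_cat_simps)
      have "g = ar (K_bimod A H) (n b \<cdot> f \<cdot> e a)"
        using ab f K_full[OF ab f] by (simp add: gf del: F_comp)
      moreover have "n b \<cdot> f \<cdot> e a \<in> hom A a b"
        using ab f by (simp add: hom_def)
      ultimately show "g \<in> ar (K_bimod A H) ` hom A a b"
        by (rule image_eqI)
    qed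
  qed
qed

lemma cofree_bimodule:
  assumes "module a h"
  shows "bimodule (T a) (F h \<cdot> l a) (d a)"
proof -
  note [simp] = module_arr[OF assms]
  show ?thesis
    using assms
    by (simp add: bimodule_def lift_module cofree_comodule d_nat' l_d)
qed

text \<open>
  Essential surjectivity is applied to the cofree bimodule on \<open>(a, h)\<close>.
\<close>

lemma K_essentially_surjective_galois:
  assumes es: "essentially_surjective A (bimodule_cat A H) (K_bimod A H)" and h: "module a h"
  shows "is_iso A (F h \<cdot> d a)"
proof -
  note [simp] = module_arr[OF h]
  obtain b g where b: "b \<in> Obj A"
    and g: "g \<in> hom (bimodule_cat A H) (ob (K_bimod A H) b) (T a, F h \<cdot> l a, d a)"
      "is_iso (bimodule_cat A H) g"
    using es cofree_bimodule[OF h] unfolding essentially_surjective_def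
    by (metis bimodule_cat_simps(1))
  obtain f where gf: "g = ((T b, m b, d b), f, (T a, F h \<cdot> l a, d a))"
    using g by (cases g) (auto simp: hom_def bimodule_cat_simps)
  have "is_iso A f"
    using g bimodule_is_iso unfolding gf by (auto simp: hom_def)
  moreover have "f \<in> hom A (T b) (T a)" "f \<cdot> m b = (F h \<cdot> l a) \<cdot> F f" "d a \<cdot> f = F f \<cdot> d b"
    using g unfolding gf by (auto simp: hom_def bimodule_cat_simps)
  ultimately show ?thesis
    using cofree_galois[OF h b, of f] by (auto simp: hom_def)
qed

lemma galois_K_essentially_surjective:
  assumes cc: "cauchy_complete A" and iso: "\<And>a h. module a h \<Longrightarrow> is_iso A (F h \<cdot> d a)"
  shows "essentially_surjective A (bimodule_cat A H) (K_bimod A H)"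
  unfolding essentially_surjective_def
proof
  fix y assume "y \<in> Obj (bimodule_cat A H)"
  then obtain a h th where y: "y = (a, h, th)" "bimodule a h th"
    by (metis bimodule_cat_simps(1) prod_cases3)
  then have "module a h" "comodule a th" "th \<cdot> h = F h \<cdot> l a \<cdot> F th" "a \<in> Obj A"
    by (auto simp: bimodule_def dest: module_arr)
  then obtain b f where b: "b \<in> Obj A" and f: "is_iso A f" "Dom A f = T b" "Cod A f = a"
    "f \<cdot> m b = h \<cdot> F f" "th \<cdot> f = F f \<cdot> d b"
    using galois_descent[OF cc _ _ _ iso iso] free_module by meson
  then have "((T b, m b, d b), f, y) \<in> hom (bimodule_cat A H) (ob (K_bimod A H) b) y"
    using y K_bimodule by (simp add: hom_def bimodule_cat_simps is_iso_def)
  moreover have "is_iso (bimodule_cat A H) ((T b, m b, d b), f, y)"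
    using calculation f bimodule_is_iso[of "T b" "m b" "d b" f a h th] y by (simp add: hom_def)
  ultimately show "\<exists>a \<in> Obj A. \<exists>f \<in> hom (bimodule_cat A H) (ob (K_bimod A H) a) y.
      is_iso (bimodule_cat A H) f"
    using b by blast
qed

lemma K_equivalence_iff:
  assumes cc: "cauchy_complete A"
  shows "is_equivalence A (bimodule_cat A H) (K_bimod A H)
    \<longleftrightarrow> (\<forall>a h. module a h \<longrightarrow> is_iso A (F h \<cdot> d a))"
proof
  assume "is_equivalence A (bimodule_cat A H) (K_bimod A H)"
  then show "\<forall>a h. module a h \<longrightarrow> is_iso A (F h \<cdot> d a)"
    by (intro allI impI K_essentially_surjective_galois equivalence_essentially_surjective)
next
  assume "\<forall>a h. module a h \<longrightarrow> is_iso A (F h \<cdot> d a)"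
  then show "is_equivalence A (bimodule_cat A H) (K_bimod A H)"
    by (intro equivalenceI K_functor K_fully_faithful galois_K_essentially_surjective cc) simp
qed

lemma equivalence_comp_K:
  assumes K: "is_equivalence A (bimodule_cat A H) (K_bimod A H)"
    and M: "is_functor (bimodule_cat A H) B M" "fully_faithful (bimodule_cat A H) B M"
      "ob M ` Obj (bimodule_cat A H) = Obj B"
  shows "is_equivalence A B (M \<circ>\<^sub>F K_bimod A H)"
proof (rule equivalenceI)
  show "is_functor A B (M \<circ>\<^sub>F K_bimod A H)"
    by (rule comp_functor[OF K_functor M(1)])
  show "fully_faithful A B (M \<circ>\<^sub>F K_bimod A H)"
    by (rule fully_faithful_comp[OF K_functor K_fully_faithful M(2)])
  show "essentially_surjective A B (M \<circ>\<^sub>F K_bimod A H)"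
    by (rule essentially_surjective_comp[OF K_functor equivalence_essentially_surjective[OF K] M(1,3)])
qed

section \<open>The comparison functors into iterated Eilenberg--Moore categories\<close>

abbreviation "hatG \<equiv> bimonad_hat_comonad A H"
abbreviation "hatT \<equiv> bimonad_hat_monad A H"
abbreviation "toG \<equiv> mixed_to_comodules A (monad_part H) (comonad_part H) (bentw H)"
abbreviation "toT \<equiv> mixed_to_modules A (monad_part H) (comonad_part H) (bentw H)"

lemma hat_comonad_structure [simp]:
  "comult hatG (a, h) = (ob (cfun hatG) (a, h), d a, ob (cfun hatG) (ob (cfun hatG) (a, h)))"
  "counit hatG (a, h) = (ob (cfun hatG) (a, h), n a, (a, h))"
  by (simp_all add: bimonad_hat_comonad_def hat_comonad_def structured_func_def Let_def)

lemma hat_monad_structure [simp]: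
  "mult hatT (a, h) = (ob (mfun hatT) (ob (mfun hatT) (a, h)), m a, ob (mfun hatT) (a, h))"
  "unit hatT (a, h) = ((a, h), e a, ob (mfun hatT) (a, h))"
  by (simp_all add: bimonad_hat_monad_def hat_monad_def structured_func_def Let_def)

lemma mixed_to_comodules_simps [simp]:
  "ob toG (a, h, th) = ((a, h), ((a, h), th, ob (cfun hatG) (a, h)))"
  "ar toG (x, f, y) = (ob toG x, (fst (ob toG x), f, fst (ob toG y)), ob toG y)"
  by (simp_all add: mixed_to_comodules_def bimonad_hat_comonad_def Let_def)

lemma mixed_to_modules_simps [simp]:
  "ob toT (a, h, th) = ((a, th), (ob (mfun hatT) (a, th), h, (a, th)))"
  "ar toT (x, f, y) = (ob toT x, (fst (ob toT x), f, fst (ob toT y)), ob toT y)"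
  by (simp_all add: mixed_to_modules_def bimonad_hat_monad_def Let_def)

lemma hat_comodules_iff:
  "((a, h), ((a', h'), th, (b, k))) \<in> comodules EMH hatG \<longleftrightarrow>
     a' = a \<and> h' = h \<and> b = T a \<and> k = F h \<cdot> l a \<and> bimodule a h th"
proof (cases "module a h")
  case True
  note [simp] = module_arr[OF True] True lift_module[OF True]
  show ?thesis
  proof (cases "a' = a \<and> h' = h \<and> b = T a \<and> k = F h \<cdot> l a")
    case True
    then show ?thesis
      by (simp add: comodules_def hom_def EM_simps bimodule_def comodule_def cong: conj_cong; blast)
  next
    case False
    then show ?thesis
      by (simp add: comodules_def hom_def EM_simps; blast)
  qed
next
  case False
  then show ?thesis
    by (auto simp: comodules_def EM_simps bimodule_def)
qed

lemma hat_modules_iff: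
  "((a, th), ((b, k), h, (a', th'))) \<in> modules coEMH hatT \<longleftrightarrow>
     a' = a \<and> th' = th \<and> b = T a \<and> k = l a \<cdot> F th \<and> bimodule a h th"
proof (cases "comodule a th")
  case True
  note [simp] = comodule_arr[OF True] True lift_comodule[OF True]
  show ?thesis
  proof (cases "a' = a \<and> th' = th \<and> b = T a \<and> k = l a \<cdot> F th")
    case True
    then show ?thesis
      by (simp add: modules_def hom_def coEM_simps bimodule_def module_def cong: conj_cong; blast)
  next
    case False
    then show ?thesis
      by (simp add: modules_def hom_def coEM_simps; blast)
  qed
next
  case False
  then show ?thesis
    by (auto simp: modules_def coEM_simps bimodule_def)
qed

lemma mixed_to_comodules_functor: "is_functor (bimodule_cat A H) (coEM EMH hatG) toG"
proof -
  interpret B: category "bimodule_cat A H"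
    by (rule bimodule_category)
  interpret C: category "coEM EMH hatG"
    by (rule coEM_category[OF hat_comonad_functor])
  show ?thesis
    by unfold_locales
      (auto simp: hom_def bimodule_cat_simps coEM_simps EM_simps hat_comodules_iff bimodule_def)
qed

lemma mixed_to_comodules_image: "ob toG ` Obj (bimodule_cat A H) = Obj (coEM EMH hatG)"
proof (intro subset_antisym subsetI)
  fix z assume "z \<in> ob toG ` Obj (bimodule_cat A H)"
  then show "z \<in> Obj (coEM EMH hatG)"
    using is_functor.ob_obj[OF mixed_to_comodules_functor] by blast
next
  fix z assume z: "z \<in> Obj (coEM EMH hatG)"
  obtain a h a' h' th b k where eq: "z = ((a, h), ((a', h'), th, (b, k)))"
    by (metis surj_pair)
  have "z = ob toG (a, h, th)" "(a, h, th) \<in> Obj (bimodule_cat A H)"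
    using z by (simp_all add: eq coEM_simps(1) hat_comodules_iff bimodule_cat_simps(1))
  then show "z \<in> ob toG ` Obj (bimodule_cat A H)"
    by (rule image_eqI)
qed

lemma mixed_to_comodules_fully_faithful: "fully_faithful (bimodule_cat A H) (coEM EMH hatG) toG"
  unfolding fully_faithful_def
proof (intro ballI, rule bij_betw_imageI)
  interpret M: is_functor "bimodule_cat A H" "coEM EMH hatG" toG
    by (rule mixed_to_comodules_functor)
  fix x y assume xy: "x \<in> Obj (bimodule_cat A H)" "y \<in> Obj (bimodule_cat A H)"
  show "inj_on (ar toG) (hom (bimodule_cat A H) x y)"
    by (auto intro!: inj_onI simp: hom_def bimodule_cat_simps)
  obtain a h th b k ze where eq: "x = (a, h, th)" "y = (b, k, ze)"
    by (metis prod_cases3)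
  show "ar toG ` hom (bimodule_cat A H) x y = hom (coEM EMH hatG) (ob toG x) (ob toG y)"
  proof (intro subset_antisym image_subsetI M.ar_hom subsetI)
    fix g assume "g \<in> hom (coEM EMH hatG) (ob toG x) (ob toG y)"
    moreover obtain u v f w z where "g = (u, (v, f, w), z)"
      by (metis prod_cases3)
    ultimately have "g = ar toG (x, f, y)" "(x, f, y) \<in> hom (bimodule_cat A H) x y"
      using xy unfolding eq by (auto simp: hom_def coEM_simps EM_simps bimodule_cat_simps)
    then show "g \<in> ar toG ` hom (bimodule_cat A H) x y"
      by blast
  qed
qed

lemma mixed_to_modules_functor: "is_functor (bimodule_cat A H) (EM coEMH hatT) toT"
proof -
  interpret B: category "bimodule_cat A H"
    by (rule bimodule_category)
  interpret C: category "EM coEMH hatT"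
    by (rule EM_category[OF hat_monad_functor])
  show ?thesis
    by unfold_locales
      (auto simp: hom_def bimodule_cat_simps coEM_simps EM_simps hat_modules_iff bimodule_def)
qed

lemma mixed_to_modules_image: "ob toT ` Obj (bimodule_cat A H) = Obj (EM coEMH hatT)"
proof (intro subset_antisym subsetI)
  fix z assume "z \<in> ob toT ` Obj (bimodule_cat A H)"
  then show "z \<in> Obj (EM coEMH hatT)"
    using is_functor.ob_obj[OF mixed_to_modules_functor] by blast
next
  fix z assume z: "z \<in> Obj (EM coEMH hatT)"
  obtain a h a' h' th b k where eq: "z = ((a, h), ((b, k), th, (a', h')))"
    by (metis surj_pair)
  have "z = ob toT (a, th, h)" "(a, th, h) \<in> Obj (bimodule_cat A H)"
    using z by (simp_all add: eq EM_simps(1) hat_modules_iff bimodule_cat_simps(1))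
  then show "z \<in> ob toT ` Obj (bimodule_cat A H)"
    by (rule image_eqI)
qed

lemma mixed_to_modules_fully_faithful: "fully_faithful (bimodule_cat A H) (EM coEMH hatT) toT"
  unfolding fully_faithful_def
proof (intro ballI, rule bij_betw_imageI)
  interpret M: is_functor "bimodule_cat A H" "EM coEMH hatT" toT
    by (rule mixed_to_modules_functor)
  fix x y assume xy: "x \<in> Obj (bimodule_cat A H)" "y \<in> Obj (bimodule_cat A H)"
  show "inj_on (ar toT) (hom (bimodule_cat A H) x y)"
    by (auto intro!: inj_onI simp: hom_def bimodule_cat_simps)
  obtain a h th b k ze where eq: "x = (a, h, th)" "y = (b, k, ze)"
    by (metis prod_cases3)
  show "ar toT ` hom (bimodule_cat A H) x y = hom (EM coEMH hatT) (ob toT x) (ob toT y)"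
  proof (intro subset_antisym image_subsetI M.ar_hom subsetI)
    fix g assume "g \<in> hom (EM coEMH hatT) (ob toT x) (ob toT y)"
    moreover obtain u v f w z where "g = (u, (v, f, w), z)"
      by (metis prod_cases3)
    ultimately have "g = ar toT (x, f, y)" "(x, f, y) \<in> hom (bimodule_cat A H) x y"
      using xy unfolding eq by (auto simp: hom_def coEM_simps EM_simps bimodule_cat_simps)
    then show "g \<in> ar toT ` hom (bimodule_cat A H) x y"
      by blast
  qed
qed

end

section \<open>The unit as a Galois grouplike morphism\<close>

lemma induction_quotient_eq:
  assumes "u x = (v, f, w)"
  shows "induction_quotient A T L u x =
    ((ob (mfun T) (Dom A f), mult T (Dom A f)), snd (ob L x) \<cdot>\<^bsub>A\<^esub> ar (mfun T) f, ob L x)"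
  using assms
  by (simp add: induction_quotient_def EM_counit_def free_def into_structured_func_def forget_def
      underlying_func_def EM_simps)

lemma restriction_simps [simp]:
  "ob (restriction A i) (a, h) = (a, h \<cdot>\<^bsub>A\<^esub> i a)"
  "ar (restriction A i) (x, f, y) = (ob (restriction A i) x, f, ob (restriction A i) y)"
  by (simp_all add: restriction_def structured_func_def)

context bimonad
begin

lemma unit_grouplike: "grouplike A (comonad_part H) e"
  using T.unit_nat by (simp add: grouplike_def n_e d_e)

lemma unit_tilde: "a \<in> Obj A \<Longrightarrow> grouplike_tilde A (monad_part H) l e a = d a"
  by (simp add: grouplike_tilde_def l_F_e)

text \<open>
  Applying \<open>F (n a)\<close> to the equation turns its right-hand side into \<open>k\<close>, and its left-hand side
  into \<open>e a \<circ> n a \<circ> k\<close>.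
\<close>

lemma coinvariant_factor:
  assumes "k \<in> Arr A" "Cod A k = T a" "a \<in> Obj A" "e (T a) \<cdot> k = d a \<cdot> k"
  shows "e a \<cdot> n a \<cdot> k = k"
proof -
  note [simp] = monad_simps
  have "k = F (n a) \<cdot> d a \<cdot> k"
    using assms(1-3) by simp
  also have "\<dots> = F (n a) \<cdot> e (T a) \<cdot> k"
    by (simp only: assms(4))
  also have "\<dots> = e a \<cdot> n a \<cdot> k"
    using assms(1-3) by simp
  finally show ?thesis
    by simp
qed

lemma unit_equaliser:
  assumes a: "a \<in> Obj A"
  shows "is_equaliser A (e a) (e (T a)) (d a)"
proof -
  have "\<exists>!w. w \<in> hom A (Dom A k) a \<and> e a \<cdot> w = k"
    if k: "k \<in> Arr A" "Cod A k = T a" "e (T a) \<cdot> k = d a \<cdot> k" for k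
  proof (rule ex1I)
    show "n a \<cdot> k \<in> hom A (Dom A k) a \<and> e a \<cdot> n a \<cdot> k = k"
      using a k coinvariant_factor[OF k(1,2) a k(3)] by (simp add: hom_def)
    fix w assume w: "w \<in> hom A (Dom A k) a \<and> e a \<cdot> w = k"
    have "w = (n a \<cdot> e a) \<cdot> w"
      using w a by (auto simp: n_e hom_def simp del: T.assoc)
    also have "\<dots> = n a \<cdot> e a \<cdot> w"
      using w a by (auto simp: hom_def)
    finally show "w = n a \<cdot> k"
      using w by simp
  qed
  moreover have "e (T a) \<cdot> e a = d a \<cdot> e a"
    using a by (simp add: d_e e_nat)
  ultimately show ?thesis
    using a by (simp add: is_equaliser_def hom_def)
qed

text \<open>
  By \<open>unit_equaliser\<close> both \<open>i\<close> and \<open>e\<close> are equalisers of \<open>e T\<close> and \<open>d\<close>, so the unit of \<open>S\<close> is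
  invertible: every object has at most one \<open>S\<close>-module structure, and every arrow between \<open>S\<close>-modules
  is linear. The left adjoint \<open>L\<close> of restriction thus takes \<open>(a, h i)\<close> to a module with the universal
  property of the free module on \<open>a\<close>, which means that the quotient map \<open>q\<close> is invertible. Composed
  with \<open>q\<close>, the Galois transformation for \<open>e\<close> becomes \<open>F h \<circ> d a\<close>.
\<close>

lemma galois_grouplike_galois:
  assumes S: "monad A S" and i: "monad_morphism A S (monad_part H) i"
    and eq: "\<forall>a \<in> Obj A. is_equaliser A (i a) (e (T a)) (grouplike_tilde A (monad_part H) l e a)"
    and adj: "is_adjunction (EM A S) EMH L (restriction A i) u c"
    and al: "\<forall>x \<in> Obj (EM A S).
           al x \<in> hom EMH (ob L x) (ob (cfun hatG) (ob L x)) \<and>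
           al x \<cdot>\<^bsub>EMH\<^esub> induction_quotient A (monad_part H) L u x =
             ar (cfun hatG) (induction_quotient A (monad_part H) L u x) \<cdot>\<^bsub>EMH\<^esub>
               (ob (free A (monad_part H)) (fst x),
                grouplike_tilde A (monad_part H) l e (fst x),
                ob (cfun hatG) (ob (free A (monad_part H)) (fst x)))"
    and gal: "comodule_functor_galois EMH L (restriction A i) c hatG al"
    and h: "module a h"
  shows "is_iso A (F h \<cdot> d a)"
proof -
  note [simp] = module_arr[OF h]
  interpret S: monad A S by fact
  interpret SF: is_functor A A "mfun S" by (rule S.functor_T)
  interpret v: natural_transformation A A id_func "mfun S" "unit S" by (rule S.unit_nat)
  interpret i: natural_transformation A A "mfun S" "bfun H" i
    using i by (simp add: monad_morphism_def)
  have iv: "i b \<cdot> unit S b = e b" if "b \<in> Obj A" for b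
    using i that by (simp add: monad_morphism_def)
  define j where "j b = n b \<cdot> i b" for b
  have j [simp]: "j b \<in> Arr A" "Dom A (j b) = ob (mfun S) b" "Cod A (j b) = b" if "b \<in> Obj A" for b
    using that by (simp_all add: j_def)
  have vj [simp]: "unit S b \<cdot> j b = Idn A (ob (mfun S) b)" if [simp]: "b \<in> Obj A" for b
  proof -
    have ib: "is_equaliser A (i b) (e (T b)) (d b)"
      using eq that unit_tilde by simp
    then have ei: "e (T b) \<cdot> i b = d b \<cdot> i b"
      by (simp add: is_equaliser_def)
    have "i b \<cdot> unit S b \<cdot> j b = (i b \<cdot> unit S b) \<cdot> j b"
      by simp
    also have "\<dots> = i b"
      using coinvariant_factor[OF _ _ that ei] by (simp add: iv j_def)
    finally have ib_eq: "i b \<cdot> unit S b \<cdot> j b = i b" .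
    have "\<exists>!w. w \<in> hom A (Dom A (i b)) (Dom A (i b)) \<and> i b \<cdot> w = i b"
      using ib ei unfolding is_equaliser_def by (simp del: i.component_arr(2))
    then have uniq: "w = w'" if "w \<in> hom A (Dom A (i b)) (Dom A (i b)) \<and> i b \<cdot> w = i b"
      "w' \<in> hom A (Dom A (i b)) (Dom A (i b)) \<and> i b \<cdot> w' = i b" for w w'
      using that by blast
    show ?thesis
      by (rule uniq) (use ib_eq in \<open>simp_all add: hom_def\<close>)
  qed
  \<comment> \<open>Both structure maps are inverse to units, hence equal to \<open>j\<close>, which is natural.\<close>
  have S_linear: "f \<cdot> k = k' \<cdot> ar (mfun S) f"
    if "(b, k) \<in> modules A S" "(b', k') \<in> modules A S" "f \<in> hom A b b'" for b k b' k' f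
  proof -
    have [simp]: "b \<in> Obj A" "k \<in> Arr A" "Dom A k = ob (mfun S) b" "Cod A k = b"
      "b' \<in> Obj A" "k' \<in> Arr A" "Dom A k' = ob (mfun S) b'" "Cod A k' = b'"
      "f \<in> Arr A" "Dom A f = b" "Cod A f = b'"
      and kv: "k \<cdot> unit S b = Idn A b" "k' \<cdot> unit S b' = Idn A b'"
      using that by (auto simp: modules_def hom_def)
    have "f \<cdot> k = f \<cdot> (k \<cdot> unit S b) \<cdot> j b"
      by simp
    also have "\<dots> = (k' \<cdot> unit S b') \<cdot> f \<cdot> j b"
      by (simp add: kv)
    also have "\<dots> = k' \<cdot> (unit S b' \<cdot> f) \<cdot> j b"
      by simp
    also have "\<dots> = k' \<cdot> ar (mfun S) f \<cdot> unit S b \<cdot> j b"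
      using v.natural[of f b'] by simp
    finally show ?thesis
      by simp
  qed
  let ?R = "restriction A i"
  interpret L: is_functor "EM A S" EMH L using adj by (simp add: is_adjunction_def)
  interpret R: is_functor EMH "EM A S" ?R using adj by (simp add: is_adjunction_def)
  interpret u: natural_transformation "EM A S" "EM A S" id_func "?R \<circ>\<^sub>F L" u
    using adj by (simp add: is_adjunction_def)
  interpret c: natural_transformation EMH EMH "L \<circ>\<^sub>F ?R" id_func c
    using adj by (simp add: is_adjunction_def)
  define y where "y = (a, h)"
  have y: "y \<in> Obj EMH"
    using h by (simp add: y_def EM_simps)
  define x where "x = ob ?R y"
  have x: "x \<in> Obj (EM A S)" and fx: "fst x = a"
    using R.ob_obj[OF y] by (simp_all add: x_def) (simp add: y_def)
  obtain p k where Lx: "ob L x = (p, k)"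
    by (metis surj_pair)
  then have pk: "module p k"
    using L.ob_obj[OF x] by (simp add: EM_simps)
  note [simp] = module_arr[OF pk]
  obtain w where ux: "u x = (x, w, ob ?R (p, k))" and w [simp]: "w \<in> Arr A" "Dom A w = a" "Cod A w = p"
    using u.component[OF x] fx Lx by (cases "u x") (auto simp: hom_def EM_simps)
  define q where "q = k \<cdot> F w"
  have q [simp]: "q \<in> Arr A" "Dom A q = T a" "Cod A q = p"
    by (simp_all add: q_def)
  have quot: "induction_quotient A (monad_part H) L u x = ((T a, m a), q, (p, k))"
    using induction_quotient_eq[where T = "monad_part H" and u = u and x = x, OF ux] by (simp add: q_def Lx)
  have qe: "q \<cdot> e a = w"
  proof -
    have "q \<cdot> e a = (k \<cdot> e p) \<cdot> w"
      by (simp add: q_def e_nat)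
    then show ?thesis
      using pk by (simp add: module_def del: T.assoc)
  qed
  have q_map: "((T a, m a), q, (p, k)) \<in> Arr EMH"
  proof -
    have "q \<cdot> m a = (k \<cdot> m p) \<cdot> F (F w)"
      by (simp add: q_def m_nat)
    also have "\<dots> = k \<cdot> F q"
      using pk by (simp add: module_def q_def del: T.assoc) simp
    finally show ?thesis
      using pk free_module by (simp add: EM_simps hom_def)
  qed
  \<comment> \<open>The inverse of \<open>q\<close> is the transpose of the unit \<open>e a\<close>, seen as an \<open>S\<close>-module map \<open>E\<close>.\<close>
  define E where "E = (x, e a, ob ?R (T a, m a))"
  have \<phi>: "(T a, m a) \<in> Obj EMH"
    by (simp add: EM_simps free_module)
  have E: "E \<in> hom (EM A S) x (ob ?R (T a, m a))"
  proof -
    have "ob ?R (T a, m a) \<in> modules A S" "x \<in> modules A S"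
      using R.ob_obj[OF \<phi>] x by (simp_all add: EM_simps)
    moreover from this have "e a \<cdot> snd x = (m a \<cdot> i (T a)) \<cdot> ar (mfun S) (e a)"
      using fx by (intro S_linear[where b = a and b' = "T a"]) (auto simp: hom_def)
    ultimately show ?thesis
      using fx by (simp add: E_def hom_def EM_simps)
  qed
  obtain r where r: "c (T a, m a) \<cdot>\<^bsub>EMH\<^esub> ar L E = ((p, k), r, (T a, m a))"
    using adjunction_transpose(1)[OF adj x \<phi> E] Lx
    by (cases "c (T a, m a) \<cdot>\<^bsub>EMH\<^esub> ar L E") (auto simp: hom_def EM_simps)
  have r_map: "((p, k), r, (T a, m a)) \<in> Arr EMH"
    using adjunction_transpose(1)[OF adj x \<phi> E] by (simp add: r hom_def)
  then have r_arr [simp]: "r \<in> Arr A" "Dom A r = p" "Cod A r = T a" and rk: "r \<cdot> k = m a \<cdot> F r"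
    by (simp_all add: EM_simps hom_def)
  have rw: "r \<cdot> w = e a"
    using adjunction_transpose(2)[OF adj x \<phi> E, unfolded r] by (simp add: ux E_def EM_simps)
  have rq: "r \<cdot> q = Idn A (T a)"
  proof -
    have "r \<cdot> q = (r \<cdot> k) \<cdot> F w"
      by (simp add: q_def)
    also have "\<dots> = m a \<cdot> F (r \<cdot> w)"
      by (simp only: rk) simp
    finally show ?thesis
      by (simp add: rw)
  qed
  have qr: "q \<cdot> r = Idn A p"
  proof -
    have "((p, k), q \<cdot> r, (p, k)) = Idn EMH (p, k)"
    proof (rule adjunction_eqI[OF adj x])
      show pk': "(p, k) \<in> Obj EMH"
        using pk by (simp add: EM_simps)
      have "((T a, m a), q, (p, k)) \<cdot>\<^bsub>EMH\<^esub> ((p, k), r, (T a, m a)) \<in> Arr EMH"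
        using q_map r_map by (intro EM.comp_arr) (simp_all add: EM_simps(3,4))
      then show "((p, k), q \<cdot> r, (p, k)) \<in> hom EMH (ob L x) (p, k)"
        by (simp add: hom_def EM_simps Lx)
      show "Idn EMH (p, k) \<in> hom EMH (ob L x) (p, k)"
        using pk' by (simp add: hom_def Lx)
      have "(q \<cdot> r) \<cdot> w = w"
        by (simp add: rw qe)
      then show "ar ?R ((p, k), q \<cdot> r, (p, k)) \<cdot>\<^bsub>EM A S\<^esub> u x = ar ?R (Idn EMH (p, k)) \<cdot>\<^bsub>EM A S\<^esub> u x"
        by (simp add: ux EM_simps)
    qed
    then show ?thesis
      by (simp add: EM_simps)
  qed
  have q_iso: "is_iso A q"
    using rq qr by (auto simp: T.is_iso_iff T.inverse_arrows_def intro!: exI[of _ r])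
  obtain t where t: "c y = ((p, k), t, y)"
    using c.component[OF y] by (cases "c y") (auto simp: hom_def EM_simps Lx simp flip: x_def)
  have t_arr [simp]: "t \<in> Arr A" "Dom A t = p" "Cod A t = a" and tk: "t \<cdot> k = h \<cdot> F t"
    using c.component[OF y, unfolded t] by (auto simp: hom_def EM_simps y_def)
  have tw: "t \<cdot> w = Idn A a"
  proof -
    have "ar ?R (c y) \<cdot>\<^bsub>EM A S\<^esub> u (ob ?R y) = Idn (EM A S) (ob ?R y)"
      using adj y by (simp add: is_adjunction_def)
    then show ?thesis
      by (simp add: t ux EM_simps fx flip: x_def)
  qed
  have tq: "t \<cdot> q = h"
  proof -
    have "t \<cdot> q = (t \<cdot> k) \<cdot> F w"
      by (simp add: q_def)
    also have "\<dots> = h \<cdot> F (t \<cdot> w)"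
      by (simp only: tk) simp
    finally show ?thesis
      by (simp add: tw)
  qed
  have alx: "al x \<in> hom EMH (p, k) (T p, F k \<cdot> l p)"
    "al x \<cdot>\<^bsub>EMH\<^esub> ((T a, m a), q, (p, k)) =
      ar (cfun hatG) ((T a, m a), q, (p, k)) \<cdot>\<^bsub>EMH\<^esub>
      ((T a, m a), d a, ob (cfun hatG) (T a, m a))"
    using al[rule_format, OF x] by (simp_all add: Lx quot fx unit_tilde)
  then obtain z where z: "al x = ((p, k), z, (T p, F k \<cdot> l p))"
    by (cases "al x") (auto simp: hom_def EM_simps)
  have z_arr [simp]: "z \<in> Arr A" "Dom A z = p" "Cod A z = T p" and zq: "z \<cdot> q = F q \<cdot> d a"
    using alx by (auto simp: z hom_def EM_simps)
  have "natural_iso EMH EMH (L \<circ>\<^sub>F ?R) (cfun hatG)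
      (\<lambda>b. ar (cfun hatG) (c b) \<cdot>\<^bsub>EMH\<^esub> al (ob ?R b))"
    using gal by (simp add: comodule_functor_galois_def)
  then have g_iso: "is_iso EMH (ar (cfun hatG) (c y) \<cdot>\<^bsub>EMH\<^esub> al x)"
    using y by (simp add: natural_iso_def x_def)
  moreover have "ar (cfun hatG) (c y) \<cdot>\<^bsub>EMH\<^esub> al x = ((p, k), F t \<cdot> z, ob (cfun hatG) y)"
    by (simp add: t z EM_simps)
  ultimately have "is_iso A (F t \<cdot> z)"
    using EMH_is_iso is_iso_def by metis
  then have "is_iso A ((F t \<cdot> z) \<cdot> q)"
    by (rule T.is_iso_comp[OF q_iso]) simp
  also have "(F t \<cdot> z) \<cdot> q = F (t \<cdot> q) \<cdot> d a"
    by (simp add: zq)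
  finally show ?thesis
    by (simp add: tq)
qed

definition identity_monad :: "('o, 'm) monad_data" where
  "identity_monad = \<lparr>mfun = id_func, mult = Idn A, unit = Idn A\<rparr>"

lemma identity_monad_simps [simp]:
  "mfun identity_monad = id_func" "mult identity_monad = Idn A" "unit identity_monad = Idn A"
  by (simp_all add: identity_monad_def)

text \<open>
  The identity monad serves as \<open>S\<close>, with \<open>i = e\<close>. Its modules are the objects of \<open>A\<close>, restriction is the
  forgetful functor and its left adjoint the free functor, so that the Galois transformation of the
  grouplike morphism \<open>e\<close> is literally that of the free functor.
\<close>

lemma free_galois_grouplike:
  assumes "comodule_functor_galois EMH (free A (monad_part H)) forget (EM_counit A (monad_part H))
     hatG (alpha_K_monad A H)"
  shows "galois_grouplike A (monad_part H) (comonad_part H) l e"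
proof -
  let ?S = identity_monad and ?T = "monad_part H"
  let ?R = "restriction A e"
  let ?L = "free A ?T \<circ>\<^sub>F forget :: (('o, 'm) sobj, ('o, 'm) sarr, ('o, 'm) sobj, ('o, 'm) sarr) func"
  let ?u = "\<lambda>x. (x, e (fst x), ob ?R (ob ?L x))"
  let ?c = "EM_counit A ?T"
  let ?al = "\<lambda>x :: ('o, 'm) sobj. alpha_K_monad A H (fst x)"
  interpret I: is_functor A A id_func
    by (rule id_functor[OF T.category_axioms])
  have I: "id_func \<circ>\<^sub>F id_func = (id_func :: ('o, 'm, 'o, 'm) func)"
    by (simp add: comp_func_def id_func_def)
  interpret Idn: natural_transformation A A id_func id_func "Idn A"
    by unfold_locales (auto simp: hom_def)
  have S: "monad A ?S"
    by unfold_locales (auto simp: I hom_def)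
  have mod: "(a, h) \<in> modules A ?S \<longleftrightarrow> a \<in> Obj A \<and> h = Idn A a" for a h
  proof
    assume "(a, h) \<in> modules A ?S"
    then have "a \<in> Obj A \<and> h \<in> hom A a a \<and> h \<cdot> Idn A a = Idn A a"
      unfolding modules_def identity_monad_simps id_func_simps by blast
    then show "a \<in> Obj A \<and> h = Idn A a"
      using T.comp_idn_right by metis
  qed (auto simp: modules_def hom_def)
  have i: "monad_morphism A ?S ?T e"
    using T.unit_nat by (simp add: monad_morphism_def m_unit')
  have eq: "is_equaliser A (e a) (e (T a)) (grouplike_tilde A ?T l e a)" if "a \<in> Obj A" for a
    using unit_equaliser[OF that] that by (simp add: unit_tilde)
  interpret ES: category "EM A ?S"
    by (rule EM_category) (simp add: I.is_functor_axioms)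
  have ES: "((a, h), f, (b, k)) \<in> Arr (EM A ?S) \<longleftrightarrow> f \<in> hom A a b \<and> a \<in> Obj A \<and> b \<in> Obj A \<and>
      h = Idn A a \<and> k = Idn A b" for a b f h k
    by (auto simp: EM_simps mod hom_def)
  interpret R: is_functor EMH "EM A ?S" ?R
    by unfold_locales (auto simp: hom_def EM_simps module_def mod)
  interpret U: is_functor "EM A ?S" A forget
    unfolding EM_def forget_def
    by (rule underlying_functor) (use ES.category_axioms in \<open>auto simp: T.category_axioms mod EM_def\<close>)
  interpret Fr: is_functor A EMH "free A ?T"
    by (rule free_functor)
  interpret L: is_functor "EM A ?S" EMH ?L
    by (rule comp_functor) unfold_locales
  interpret RL: is_functor "EM A ?S" "EM A ?S" "?R \<circ>\<^sub>F ?L"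
    by (rule comp_functor) unfold_locales
  interpret LR: is_functor EMH EMH "?L \<circ>\<^sub>F ?R"
    by (rule comp_functor) unfold_locales
  interpret I1: is_functor "EM A ?S" "EM A ?S" id_func
    by (rule id_functor) unfold_locales
  interpret I2: is_functor EMH EMH id_func
    by (rule id_functor) unfold_locales
  have u: "natural_transformation (EM A ?S) (EM A ?S) id_func (?R \<circ>\<^sub>F ?L) ?u"
    by unfold_locales (auto simp: hom_def EM_simps mod e_nat)
  have c: "natural_transformation EMH EMH (?L \<circ>\<^sub>F ?R) id_func ?c"
    by unfold_locales
      (auto simp: hom_def EM_simps module_def EM_counit_def m_assoc)
  have adj: "is_adjunction (EM A ?S) EMH ?L ?R ?u ?c"
    unfolding is_adjunction_def
    using u c L.is_functor_axioms R.is_functor_axioms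
    by (auto simp: EM_simps EM_counit_def mod module_def)
  have quot: "induction_quotient A ?T ?L ?u x =
      ((T (fst x), m (fst x)), Idn A (T (fst x)), (T (fst x), m (fst x)))" if "fst x \<in> Obj A" for x
    using that by (subst induction_quotient_eq[OF refl]) simp
  have LR: "?L \<circ>\<^sub>F ?R = free A ?T \<circ>\<^sub>F forget"
    by (auto simp: comp_func_def restriction_def structured_func_def forget_def underlying_func_def
        case_prod_unfold)
  have gal: "comodule_functor_galois EMH ?L ?R ?c hatG ?al"
    using assms unfolding comodule_functor_galois_def LR
    by (simp add: restriction_def structured_func_def case_prod_unfold)
  have al: "?al x \<in> hom EMH (ob ?L x) (ob (cfun hatG) (ob ?L x)) \<and>
     ?al x \<cdot>\<^bsub>EMH\<^esub> induction_quotient A ?T ?L ?u x =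
       ar (cfun hatG) (induction_quotient A ?T ?L ?u x) \<cdot>\<^bsub>EMH\<^esub>
         (ob (free A ?T) (fst x), grouplike_tilde A ?T l e (fst x),
          ob (cfun hatG) (ob (free A ?T) (fst x)))" if "x \<in> Obj (EM A ?S)" for x
  proof -
    have x: "fst x \<in> Obj A"
      using that mod by (cases x) (auto simp: EM_simps)
    show ?thesis
      unfolding quot[OF x]
      using x by (simp add: unit_tilde alpha_K_monad_def EM_simps hom_def free_module
          lift_module d_m)
  qed
  have "\<exists>S i L u c al. monad A S \<and> monad_morphism A S ?T i \<and>
     (\<forall>a \<in> Obj A. is_equaliser A (i a) (e (T a)) (grouplike_tilde A ?T l e a)) \<and>
     is_adjunction (EM A S) EMH L (restriction A i) u c \<and>
     (\<forall>x \<in> Obj (EM A S).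
           al x \<in> hom EMH (ob L x) (ob (cfun hatG) (ob L x)) \<and>
           al x \<cdot>\<^bsub>EMH\<^esub> induction_quotient A ?T L u x =
             ar (cfun hatG) (induction_quotient A ?T L u x) \<cdot>\<^bsub>EMH\<^esub>
               (ob (free A ?T) (fst x), grouplike_tilde A ?T l e (fst x),
                ob (cfun hatG) (ob (free A ?T) (fst x)))) \<and>
     comodule_functor_galois EMH L (restriction A i) c hatG al"
    by (rule exI[of _ ?S], rule exI[of _ e], rule exI[of _ ?L], rule exI[of _ ?u],
        rule exI[of _ ?c], rule exI[of _ ?al]) (use S i eq adj al gal in blast)
  then show ?thesis
    unfolding galois_grouplike_def using unit_grouplike
    by (simp add: bimonad_hat_comonad_def)
qed

end

section \<open>The equivalence theorem\<close>

theorem mainTheorem2: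
  fixes A :: "('o, 'm) cat" and H :: "('o, 'm) bimonad_data"
  assumes "bimonad A H" and "cauchy_complete A"
  shows "all_equivalent
    [comodule_functor_galois (EM A (monad_part H)) (free A (monad_part H)) forget
       (EM_counit A (monad_part H)) (bimonad_hat_comonad A H) (alpha_K_monad A H),
     module_functor_galois (coEM A (comonad_part H)) (cofree A (comonad_part H)) forget
       (coEM_unit A (comonad_part H)) (bimonad_hat_monad A H) (alpha_K_comonad A H),
     galois_grouplike A (monad_part H) (comonad_part H) (bentw H) (bunit H),
     is_equivalence A (bimodule_cat A H) (K_bimod A H),
     natural_iso A A (bfun H \<circ>\<^sub>F bfun H) (bfun H \<circ>\<^sub>F bfun H)
       (\<lambda>a. ar (bfun H) (bmult H a) \<cdot>\<^bsub>A\<^esub> bcomult H (ob (bfun H) a)),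
     natural_iso A A (bfun H \<circ>\<^sub>F bfun H) (bfun H \<circ>\<^sub>F bfun H)
       (\<lambda>a. bmult H (ob (bfun H) a) \<cdot>\<^bsub>A\<^esub> ar (bfun H) (bcomult H a)),
     (\<exists>S. is_antipode A H S)]
   \<and> (is_equivalence A (bimodule_cat A H) (K_bimod A H) \<longrightarrow>
        is_equivalence A (coEM (EM A (monad_part H)) (bimonad_hat_comonad A H)) (K_monad A H) \<and>
        is_equivalence A (EM (coEM A (comonad_part H)) (bimonad_hat_monad A H)) (K_comonad A H))"
proof -
  interpret bimonad A H
    by fact
  let ?galois = "\<forall>a h. module a h \<longrightarrow> is_iso A (F h \<cdot>\<^bsub>A\<^esub> d a)"
  have grouplike: "galois_grouplike A (monad_part H) (comonad_part H) l e \<longleftrightarrow> ?galois"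
  proof
    assume *: "galois_grouplike A (monad_part H) (comonad_part H) l e"
    have "is_iso A (F h \<cdot>\<^bsub>A\<^esub> d a)" if "module a h" for a h
      using * that
      unfolding galois_grouplike_def parts_simps bimonad_hat_comonad_def[symmetric]
      by (elim conjE exE) (rule galois_grouplike_galois)
    then show ?galois
      by blast
  next
    assume ?galois
    then show "galois_grouplike A (monad_part H) (comonad_part H) l e"
      by (intro free_galois_grouplike) (simp only: free_galois_iff)
  qed
  have antipode: "(\<exists>S. is_antipode A H S) \<longleftrightarrow> (\<exists>S. antipode S)"
    by (simp only: antipode_iff)
  have "is_equivalence A (coEM EMH (bimonad_hat_comonad A H)) (K_monad A H)"
    "is_equivalence A (EM coEMH (bimonad_hat_monad A H)) (K_comonad A H)"
    if "is_equivalence A (bimodule_cat A H) (K_bimod A H)"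
    unfolding K_monad_def K_comonad_def
    by (rule equivalence_comp_K[OF that mixed_to_comodules_functor
          mixed_to_comodules_fully_faithful mixed_to_comodules_image])
      (rule equivalence_comp_K[OF that mixed_to_modules_functor
          mixed_to_modules_fully_faithful mixed_to_modules_image])
  then show ?thesis
    unfolding all_equivalent_def free_galois_iff cofree_galois_iff grouplike
      K_equivalence_iff[OF \<open>cauchy_complete A\<close>] galois_iff cogalois_iff antipode
    using antipode_iff_galois antipode_iff_galois_module antipode_iff_cogalois by simp
qed

end
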